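(* Let $D=(V(D),E(D),w)$ be a vertex-weighted oriented star graph with vertex set $V(D)=\{x_1,\ldots,x_n\}$ such that $w(x)\ge 2$ for every vertex $x$ of $D$. Suppose that the edge set $E(D)$ is one of the following three sets: $\{x_1x_2,x_1x_3,\ldots,x_1x_n\}$, $\{x_2x_1,x_3x_1,\ldots,x_nx_1\}$, or $\{x_1x_2,x_2x_3,\ldots,x_2x_n\}$ (in the last set, all edges other than $x_1x_2$ are the edges $x_2x_j$ with $3\le j\le n$). Then $$\operatorname{pd}(I(D))=|E(D)|-1\quad\text{and}\quad \operatorname{reg}(I(D))=\sum_{x\in V(D)}w(x)-|E(D)|+1.$$
   Context: A vertex-weighted oriented graph is a triple $D=(V(D),E(D),w)$, where $V(D)=\{x_1,\dots,x_n\}$ is a finite vertex set, $E(D)$ is a set of ordered pairs of distinct vertices such that each pair of vertices is joined by at most one edge, in only one direction, and $w:V(D)\to\{1,2,\ldots\}$ is a weight function. An edge written $uv$ is directed from its starting point $u$ to its ending point $v$. Put $w_j=w(x_j)$. Let $k$ be a field and $S=k[x_1,\ldots,x_n]$ with the standard grading. The edge ideal of $D$ is the ideal $I(D)=(x_ix_j^{w_j}\mid x_ix_j\in E(D))\subset S$, where $x_ix_j\in E(D)$ is directed from $x_i$ to $x_j$. For a homogeneous ideal $I\subset S$ with graded Betti numbers $\beta_{i,j}(I)$ of $I$ as an $S$-module (so $\beta_{0,j}(I)$ is the number of minimal generators of degree $j$), $\operatorname{pd}(I)=\max\{i\mid\beta_{i,j}(I)\ne0 \text{ for some } j\}$ and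 $\operatorname{reg}(I)=\max\{j-i\mid\beta_{i,j}(I)\neq 0\}$.
   Formalization: As printed the regularity formula fails (I(D) ignores weights of sources): here each vertex without incoming edge counts as weight 1 in the sum, w(x)≥2 is required only of vertices with an incoming edge (w≥1 elsewhere), and n≥2. *)

theory Defs
  imports
    "HOL-Library.Poly_Mapping"
    "Jordan_Normal_Form.Matrix_Kernel"
begin

section \<open>The standard graded polynomial ring\<close>

text \<open>
  For a finite type \<open>'v\<close> of variables and a field \<open>'k\<close>, the type \<open>('v, 'k) mpol\<close> is the
  polynomial ring \<open>k[x | x \<in> V]\<close>: a polynomial maps monomials, given by their exponent vectors
  \<open>'v \<Rightarrow>\<^sub>0 nat\<close>, to coefficients, and multiplication is the convolution product of
  \<open>Poly_Mapping\<close>.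
\<close>

type_synonym ('v, 'k) mpol = "('v \<Rightarrow>\<^sub>0 nat) \<Rightarrow>\<^sub>0 'k"

definition mvar :: "'v \<Rightarrow> ('v, 'k::field) mpol" where
  "mvar v = Poly_Mapping.single (Poly_Mapping.single v 1) 1"

definition mon_degree :: "('v::finite \<Rightarrow>\<^sub>0 nat) \<Rightarrow> nat" where
  "mon_degree m = (\<Sum>v\<in>UNIV. Poly_Mapping.lookup m v)"

section \<open>Graded Betti numbers, projective dimension and regularity\<close>

text \<open>
  A list \<open>ds\<close> of degrees stands for the graded free module \<open>F(ds) = \<Oplus>\<^sub>r S(-ds!r)\<close>, whose
  elements are the vectors of length \<open>length ds\<close> and whose \<open>r\<close>-th basis vector has degree
  \<open>ds!r\<close>. The predicate \<open>graded_map ds es A\<close> says that \<open>A\<close> is the matrix of a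
  degree-preserving \<open>S\<close>-linear map from \<open>F(es)\<close> to \<open>F(ds)\<close>: the entry in row \<open>r\<close> and column
  \<open>c\<close> is homogeneous of degree \<open>es!c - ds!r\<close>, hence zero if this number is negative.
  For ideals the generator degrees in a minimal resolution are never negative, so natural numbers
  suffice.
\<close>

definition graded_map ::
  "nat list \<Rightarrow> nat list \<Rightarrow> ('v::finite, 'k::field) mpol mat \<Rightarrow> bool" where
  "graded_map ds es A \<longleftrightarrow>
     A \<in> carrier_mat (length ds) (length es) \<and>
     (\<forall>r<length ds. \<forall>c<length es. \<forall>m\<in>Poly_Mapping.keys (A $$ (r, c)).
        mon_degree m + ds ! r = es ! c)"

definition mat_image :: "'a::comm_ring_1 mat \<Rightarrow> 'a vec set" where
  "mat_image A = {A *\<^sub>v v | v. v \<in> carrier_vec (dim_col A)}"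

text \<open>
  \<open>minimal_graded_free_resolution I d A\<close>: the sequence
  \<open>\<dots> \<rightarrow> F(d 2) \<rightarrow> F(d 1) \<rightarrow> F(d 0) \<rightarrow> I \<rightarrow> 0\<close>
  is a minimal graded free resolution of \<open>I\<close>. The map from \<open>F(d (i + 1))\<close> to \<open>F(d i)\<close> is
  \<open>A (i + 1)\<close>, and \<open>A 0\<close> is the augmentation \<open>F(d 0) \<rightarrow> I\<close>, viewed as a \<open>1 \<times> length (d 0)\<close>
  matrix with values in \<open>S = F([0])\<close>. Minimality means that the entries of \<open>A (i + 1)\<close> lie in
  the maximal ideal generated by the variables, i.e. have constant coefficient zero.
  A resolution of finite length is padded with empty lists, that is, with zero modules.
\<close>

definition minimal_graded_free_resolution ::
  "('v::finite, 'k::field) mpol set \<Rightarrow> (nat \<Rightarrow> nat list) \<Rightarrow> (nat \<Rightarrow> ('v, 'k) mpol mat) \<Rightarrow> bool"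
where
  "minimal_graded_free_resolution I d A \<longleftrightarrow>
     graded_map [0] (d 0) (A 0) \<and>
     (\<forall>i. graded_map (d i) (d (Suc i)) (A (Suc i))) \<and>
     (\<lambda>v. v $ 0) ` mat_image (A 0) = I \<and>
     (\<forall>i. mat_kernel (A i) = mat_image (A (Suc i))) \<and>
     (\<forall>i. \<forall>r<length (d i). \<forall>c<length (d (Suc i)).
        Poly_Mapping.lookup (A (Suc i) $$ (r, c)) 0 = 0)"

text \<open>
  \<open>\<beta>\<^sub>i\<^sub>,\<^sub>j(I)\<close> is the number of summands \<open>S(-j)\<close> in homological degree \<open>i\<close> of a minimal graded
  free resolution of \<open>I\<close>; it does not depend on the resolution.
\<close>

definition graded_betti :: "('v::finite, 'k::field) mpol set \<Rightarrow> nat \<Rightarrow> nat \<Rightarrow> nat" where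
  "graded_betti I i j =
     (THE b. \<exists>d A. minimal_graded_free_resolution I d A \<and> b = count_list (d i) j)"

definition proj_dim :: "('v::finite, 'k::field) mpol set \<Rightarrow> nat" where
  "proj_dim I = Max {i. \<exists>j. graded_betti I i j \<noteq> 0}"

definition regularity :: "('v::finite, 'k::field) mpol set \<Rightarrow> int" where
  "regularity I = Max {int j - int i | i j. graded_betti I i j \<noteq> 0}"

section \<open>Vertex-weighted oriented graphs\<close>

text \<open>
  The vertex set is the whole finite type \<open>'v\<close>; the pair \<open>(u, v)\<close> is the edge \<open>uv\<close> directed from
  \<open>u\<close> to \<open>v\<close>.
\<close>

definition weighted_oriented_graph :: "('v::finite \<times> 'v) set \<Rightarrow> ('v \<Rightarrow> nat) \<Rightarrow> bool" where
  "weighted_oriented_graph E w \<longleftrightarrow>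
     (\<forall>u v. (u, v) \<in> E \<longrightarrow> u \<noteq> v \<and> (v, u) \<notin> E) \<and> (\<forall>v. 1 \<le> w v)"

text \<open>The underlying undirected graph is a star with centre \<open>c\<close>.\<close>

definition star_graph :: "('v::finite \<times> 'v) set \<Rightarrow> bool" where
  "star_graph E \<longleftrightarrow> (\<exists>c. {{u, v} | u v. (u, v) \<in> E} = {{c, v} | v. v \<noteq> c})"

definition edge_ideal :: "('v::finite \<times> 'v) set \<Rightarrow> ('v \<Rightarrow> nat) \<Rightarrow> ('v, 'k::field) mpol set" where
  "edge_ideal E w = module.span (*) {mvar u * mvar v ^ w v | u v. (u, v) \<in> E}"

text \<open>
  The edge ideal does not depend on the weights of the sources (the vertices without incoming
  edges). The usual convention for weighted oriented graphs is therefore that a source has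
  weight \<open>1\<close>, and formulas that sum the weights of all vertices, such as the one for the
  regularity, refer to weights normalised in this way: for the single edge \<open>uv\<close>, the ideal
  generated by \<open>u v\<^sup>w\<^sup>(\<^sup>v\<^sup>)\<close> has regularity \<open>1 + w(v)\<close>, whatever \<open>w(u)\<close> is.
\<close>

definition normalized_weight :: "('v::finite \<times> 'v) set \<Rightarrow> ('v \<Rightarrow> nat) \<Rightarrow> 'v \<Rightarrow> nat" where
  "normalized_weight E w v = (if \<exists>u. (u, v) \<in> E then w v else 1)"

end

theory Submission
  imports Defs
begin

text \<open>
  In each of the three cases all generators of the edge ideal are divisible by one monomial \<open>h\<close>:
  the centre of the star if it is the starting point of all edges or of all but one, and the power
  of the centre given by its weight if all edges end there. After division by \<open>h\<close> the generators are
  monomials \<open>f\<^sub>1, \<dots>, f\<^sub>m\<close>, one for each edge, no two of which share a variable. Such monomials form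
  a regular sequence (\<open>regular_sequence_monomials\<close>), so the Koszul complex on them is a minimal free
  resolution of the quotient by \<open>(f\<^sub>1, \<dots>, f\<^sub>m)\<close>. Multiplication by \<open>h\<close> identifies
  \<open>(f\<^sub>1, \<dots>, f\<^sub>m)\<close>, shifted by the degree of \<open>h\<close>, with the edge ideal, so a truncation of the Koszul
  complex resolves the edge ideal (\<open>koszul_resolution\<close>). Its last module has homological degree
  \<open>m - 1\<close> and is generated in degree \<open>deg h + \<Sum> deg f\<^sub>i\<close>, where the regularity is attained. Hence the
  projective dimension is \<open>m - 1\<close> and the regularity is \<open>deg h + \<Sum> deg f\<^sub>i - m + 1\<close>, and
  \<open>deg h + \<Sum> deg f\<^sub>i\<close> is the sum of the normalised weights in each case.

  The Koszul complex is built as an iterated mapping cone. Adding \<open>f\<close> to the sequence keeps the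
  complex exact because \<open>f\<close> is a nonzerodivisor modulo the previous elements (\<open>cone_mat_exact\<close>,
  \<open>koszul_exact\<close>).

  Reading off Betti numbers from one resolution requires that they do not depend on the resolution
  (\<open>graded_betti_eq_count\<close>). Two minimal resolutions of an ideal are connected by graded chain maps
  in both directions whose composite is homotopic to the identity (\<open>comparison_up_to_homotopy\<close>).
  By minimality the homotopy terms vanish modulo the maximal ideal, so the composite becomes the
  identity over the field, degree by degree, and a rank comparison bounds the number of basis vectors
  of each degree in one resolution by that in the other.
\<close>

section \<open>Homogeneous components\<close>

text \<open>
  For an entry in a row of degree \<open>d\<close> and a column of degree \<open>e\<close> of a graded map, this is the part
  that has the right degree \<open>e - d\<close>; writing the condition additively makes it \<open>0\<close> if \<open>e < d\<close>, as
  in the definition of a graded map.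
\<close>

definition hom_part :: "nat \<Rightarrow> nat \<Rightarrow> ('v::finite, 'k::field) mpol \<Rightarrow> ('v, 'k) mpol" where
  "hom_part d e p = Poly_Mapping.mapp (\<lambda>m c. c when mon_degree m + d = e) p"

lemma lookup_hom_part:
  "Poly_Mapping.lookup (hom_part d e p) m = (Poly_Mapping.lookup p m when mon_degree m + d = e)"
  by (auto simp: hom_part_def lookup_mapp when_def in_keys_iff)

lemma keys_hom_part:
  "m \<in> Poly_Mapping.keys (hom_part d e p) \<longleftrightarrow> m \<in> Poly_Mapping.keys p \<and> mon_degree m + d = e"
  by (auto simp: in_keys_iff lookup_hom_part)

lemma hom_part_add: "hom_part d e (p + q) = hom_part d e p + hom_part d e q"
  by (rule poly_mapping_eqI) (simp add: lookup_hom_part lookup_add when_def)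

lemma hom_part_sum: "hom_part d e (sum f X) = (\<Sum>x\<in>X. hom_part d e (f x))"
  by (rule poly_mapping_eqI) (simp add: lookup_hom_part lookup_sum when_def)

lemma hom_part_homogeneous:
  assumes "\<forall>m\<in>Poly_Mapping.keys p. mon_degree m + d = e"
  shows "hom_part d e p = p"
  using assms by (intro poly_mapping_eqI) (auto simp: lookup_hom_part when_def in_keys_iff)

lemma hom_part_eq_0:
  assumes "\<forall>m\<in>Poly_Mapping.keys p. mon_degree m + d \<noteq> e"
  shows "hom_part d e p = 0"
  using assms by (intro poly_mapping_eqI) (auto simp: lookup_hom_part when_def in_keys_iff)

lemma mon_degree_add: "mon_degree (s + t) = mon_degree s + mon_degree t"
  by (simp add: mon_degree_def lookup_add sum.distrib)

text \<open>
  Split \<open>p\<close> into its part of degree \<open>f - e\<close> and the rest: after multiplication with the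
  homogeneous \<open>b\<close> only the products with the former have degree \<open>f - d\<close>.
\<close>

lemma hom_part_mult_homogeneous:
  assumes "\<forall>m\<in>Poly_Mapping.keys b. mon_degree m + d = e"
  shows "hom_part d f (b * p) = b * hom_part e f p"
proof -
  let ?q = "p - hom_part e f p"
  have q: "mon_degree m + e \<noteq> f" if "m \<in> Poly_Mapping.keys ?q" for m
    using that by (auto simp: in_keys_iff lookup_minus lookup_hom_part when_def)
  have "hom_part d f (b * hom_part e f p) = b * hom_part e f p"
  proof (rule hom_part_homogeneous, rule ballI)
    fix m assume "m \<in> Poly_Mapping.keys (b * hom_part e f p)"
    then obtain k l where "m = k + l" "k \<in> Poly_Mapping.keys b" "l \<in> Poly_Mapping.keys (hom_part e f p)"
      using keys_mult by blast
    then show "mon_degree m + d = f"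
      using assms by (auto simp: keys_hom_part mon_degree_add)
  qed
  moreover have "hom_part d f (b * ?q) = 0"
  proof (rule hom_part_eq_0, rule ballI)
    fix m assume "m \<in> Poly_Mapping.keys (b * ?q)"
    then obtain k l where m: "m = k + l" and k: "k \<in> Poly_Mapping.keys b"
      and l: "l \<in> Poly_Mapping.keys ?q"
      using keys_mult by blast
    have "mon_degree k + d = e" using assms k by blast
    then show "mon_degree m + d \<noteq> f"
      using q[OF l] m by (auto simp: mon_degree_add)
  qed
  moreover have "b * p = b * hom_part e f p + b * ?q"
    by (simp add: algebra_simps)
  ultimately show ?thesis
    by (metis add.right_neutral hom_part_add)
qed

section \<open>Constant coefficients\<close>

lemma exponents_add_eq_0:
  fixes s t :: "'v \<Rightarrow>\<^sub>0 nat"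
  assumes "s + t = 0"
  shows "s = 0 \<and> t = 0"
proof -
  have "Poly_Mapping.lookup s v + Poly_Mapping.lookup t v = 0" for v
    using arg_cong[OF assms, of "\<lambda>u. Poly_Mapping.lookup u v"] by (simp add: lookup_add)
  then show ?thesis
    by (auto intro!: poly_mapping_eqI)
qed

lemma update_eq_add_single:
  fixes q :: "'a \<Rightarrow>\<^sub>0 'b::monoid_add"
  assumes "a \<notin> Poly_Mapping.keys q"
  shows "Poly_Mapping.update a b q = q + Poly_Mapping.single a b"
  using assms by (intro poly_mapping_eqI)
    (auto simp: lookup_update lookup_add lookup_single when_def in_keys_iff)

lemma lookup_single_mult:
  "Poly_Mapping.lookup (Poly_Mapping.single t c * q) (t + u) = c * Poly_Mapping.lookup (q :: ('v, 'k::field) mpol) u"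
proof (induction q rule: update_induct)
  case const
  then show ?case by simp
next
  case (update q a b)
  note eq = update_eq_add_single[OF update(1)]
  show ?case
    unfolding eq using update(3)
    by (simp add: distrib_left lookup_add mult_single lookup_single when_def)
qed

text \<open>
  Reduction modulo the maximal ideal generated by the variables is a ring homomorphism, because a
  sum of exponent vectors vanishes only if both summands do.
\<close>

lemma const_coeff_mult:
  fixes p q :: "('v, 'k::field) mpol"
  shows "Poly_Mapping.lookup (p * q) 0 = Poly_Mapping.lookup p 0 * Poly_Mapping.lookup q 0"
proof -
  let ?p0 = "Poly_Mapping.single 0 (Poly_Mapping.lookup p 0)"
  have "0 \<notin> Poly_Mapping.keys ((p - ?p0) * q)"
  proof
    assume "0 \<in> Poly_Mapping.keys ((p - ?p0) * q)"
    then obtain k l where "k + l = 0" "k \<in> Poly_Mapping.keys (p - ?p0)"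
      using keys_mult by (smt (verit) mem_Collect_eq subsetD)
    then show False
      using exponents_add_eq_0[of k l] by (auto simp: in_keys_iff lookup_minus)
  qed
  then have "Poly_Mapping.lookup ((p - ?p0) * q) 0 = 0"
    by (simp add: in_keys_iff)
  moreover have "p * q = ?p0 * q + (p - ?p0) * q"
    by (simp add: algebra_simps)
  moreover have "Poly_Mapping.lookup (?p0 * q) 0 = Poly_Mapping.lookup p 0 * Poly_Mapping.lookup q 0"
    using lookup_single_mult[of 0 _ q 0] by simp
  ultimately show ?thesis
    by (simp add: lookup_add)
qed

interpretation const_coeff: semiring_hom "\<lambda>p :: ('v, 'k::field) mpol. Poly_Mapping.lookup p 0"
  by standard (simp_all add: lookup_add const_coeff_mult)

section \<open>Lifting along graded maps\<close>

text \<open>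
  Projectivity of graded free modules. An arbitrary lift of each column exists because the column
  lies in the image of \<open>B\<close>; replacing its entries by their homogeneous parts of the required degree
  keeps it a lift, as \<open>B\<close> and \<open>M\<close> are graded.
\<close>

lemma graded_lift:
  fixes B M :: "('v::finite, 'k::field) mpol mat"
  assumes B: "graded_map ds es B" and M: "graded_map ds fs M"
    and im: "\<And>c. c < length fs \<Longrightarrow> col M c \<in> mat_image B"
  obtains N where "graded_map es fs N" "B * N = M"
proof -
  have Bc: "B \<in> carrier_mat (length ds) (length es)" and Mc: "M \<in> carrier_mat (length ds) (length fs)"
    using B M by (auto simp: graded_map_def)
  have "\<forall>c. \<exists>v. c < length fs \<longrightarrow> v \<in> carrier_vec (length es) \<and> B *\<^sub>v v = col M c"
    using im Bc unfolding mat_image_def by fastforce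
  then obtain v where v: "\<And>c. c < length fs \<Longrightarrow> v c \<in> carrier_vec (length es) \<and> B *\<^sub>v v c = col M c"
    by metis
  define N where "N = mat (length es) (length fs) (\<lambda>(r, c). hom_part (es ! r) (fs ! c) (v c $ r))"
  have "graded_map es fs N"
    by (auto simp: graded_map_def N_def keys_hom_part)
  moreover have "B * N = M"
  proof (rule eq_matI)
    fix r c assume rc: "r < dim_row M" "c < dim_col M"
    then have r: "r < length ds" and c: "c < length fs" using Mc by auto
    have "(B * N) $$ (r, c) = (\<Sum>k<length es. B $$ (r, k) * hom_part (es ! k) (fs ! c) (v c $ k))"
      using r c Bc by (auto simp: N_def scalar_prod_def lessThan_atLeast0)
    also have "\<dots> = (\<Sum>k<length es. hom_part (ds ! r) (fs ! c) (B $$ (r, k) * v c $ k))"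
      using B r by (intro sum.cong refl hom_part_mult_homogeneous[symmetric])
        (auto simp: graded_map_def)
    also have "\<dots> = hom_part (ds ! r) (fs ! c) ((B *\<^sub>v v c) $ r)"
      using r Bc conjunct1[OF v[OF c]] by (auto simp: scalar_prod_def lessThan_atLeast0 hom_part_sum)
    also have "\<dots> = hom_part (ds ! r) (fs ! c) (M $$ (r, c))"
      using v[OF c] rc by simp
    also have "\<dots> = M $$ (r, c)"
      using M r c by (intro hom_part_homogeneous) (auto simp: graded_map_def)
    finally show "(B * N) $$ (r, c) = M $$ (r, c)" .
  qed (use Bc Mc in \<open>auto simp: N_def\<close>)
  ultimately show ?thesis using that by blast
qed

lemma col_in_image_if_mult_0:
  assumes "mat_kernel A = mat_image B" "A \<in> carrier_mat p q" "M \<in> carrier_mat q s"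
    and "A * M = 0\<^sub>m p s" "c < s"
  shows "col M c \<in> mat_image B"
proof -
  have "A *\<^sub>v col M c = col (A * M) c"
    using col_mult2[OF assms(2,3,5)] by simp
  also have "\<dots> = 0\<^sub>v p"
    unfolding assms(4) using assms(5) by simp
  finally have "col M c \<in> mat_kernel A"
    using assms by (auto intro!: mat_kernelI[of A p q])
  then show ?thesis using assms by simp
qed

text \<open>
  The ungraded counterpart. It suffices for the homotopies below, of which only the residues modulo
  the maximal ideal matter.
\<close>

lemma lift_through_kernel:
  assumes "mat_kernel A = mat_image B" "A \<in> carrier_mat p q" "B \<in> carrier_mat q t" "M \<in> carrier_mat q s"
    and "A * M = 0\<^sub>m p s"
  obtains N where "N \<in> carrier_mat t s" "B * N = M"
proof -
  have "\<forall>c. \<exists>v. c < s \<longrightarrow> v \<in> carrier_vec t \<and> B *\<^sub>v v = col M c"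
    using col_in_image_if_mult_0[OF assms(1,2,4,5)] assms(3) unfolding mat_image_def by fastforce
  then obtain v where v: "\<And>c. c < s \<Longrightarrow> v c \<in> carrier_vec t \<and> B *\<^sub>v v c = col M c"
    by metis
  define N where "N = mat t s (\<lambda>(r, c). v c $ r)"
  have "B * N = M"
  proof (rule mat_col_eqI)
    fix c assume "c < dim_col M"
    then have c: "c < s" using assms by auto
    have "col N c = v c" using v[OF c] c by (auto simp: N_def)
    then show "col (B * N) c = col M c"
      using v[OF c] c assms by (subst col_mult2[of B q t N s]) (auto simp: N_def)
  qed (use assms in \<open>auto simp: N_def\<close>)
  then show ?thesis using that[of N] by (auto simp: N_def)
qed

lemma mult_eq_0_if_image_subset_kernel:
  assumes "mat_kernel A = mat_image B" "A \<in> carrier_mat p q" "B \<in> carrier_mat q t"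
  shows "A * B = 0\<^sub>m p t"
proof (rule mat_col_eqI)
  fix c assume "c < dim_col (0\<^sub>m p t :: 'a mat)"
  then have c: "c < t" by simp
  have "col B c = B *\<^sub>v unit_vec t c"
    using assms c by (intro eq_vecI) auto
  then have "col B c \<in> mat_kernel A"
    using assms unfolding mat_image_def by auto
  then have "A *\<^sub>v col B c = 0\<^sub>v p"
    using assms(2) mat_kernelD(2) by blast
  then show "col (A * B) c = col (0\<^sub>m p t) c"
    unfolding col_mult2[OF assms(2,3) c] using c by simp
qed (use assms in auto)

section \<open>Uniqueness of the graded Betti numbers\<close>

text \<open>
  A matrix with a right inverse has at least as many columns as rows. If there were fewer columns,
  padding both factors with zeros to square matrices would make a product of singular matrices the
  identity. Index sets instead of dimensions allow restricting a matrix to the rows and columns of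
  one degree without renumbering them.
\<close>

lemma card_le_if_one_sided_inverse:
  fixes P Q :: "nat \<Rightarrow> nat \<Rightarrow> 'k::field"
  assumes "finite J" "finite K"
    and inv: "\<And>r s. r \<in> J \<Longrightarrow> s \<in> J \<Longrightarrow> (\<Sum>c\<in>K. P r c * Q c s) = (if r = s then 1 else 0)"
  shows "card J \<le> card K"
proof (rule ccontr)
  assume "\<not> card J \<le> card K"
  define a b where "a = card J" and "b = card K"
  have lt: "b < a" using \<open>\<not> _\<close> by (simp add: a_def b_def)
  obtain f where f: "bij_betw f {0..<a} J"
    using ex_bij_betw_nat_finite[OF assms(1)] unfolding a_def by blast
  obtain g where g: "bij_betw g {0..<b} K"
    using ex_bij_betw_nat_finite[OF assms(2)] unfolding b_def by blast
  let ?P = "mat a a (\<lambda>(i, l). if l < b then P (f i) (g l) else 0)"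
  let ?Q = "mat a a (\<lambda>(l, i). if l < b then Q (g l) (f i) else 0)"
  have "?P * ?Q = 1\<^sub>m a"
  proof (rule eq_matI)
    fix i j assume "i < dim_row (1\<^sub>m a :: 'k mat)" "j < dim_col (1\<^sub>m a :: 'k mat)"
    then have ij: "i < a" "j < a" by auto
    have fij: "f i \<in> J" "f j \<in> J" "f i = f j \<longleftrightarrow> i = j"
      using f ij by (auto simp: bij_betw_def inj_on_def)
    have "(?P * ?Q) $$ (i, j) = (\<Sum>l=0..<a. if l < b then P (f i) (g l) * Q (g l) (f j) else 0)"
      using ij by (auto simp: scalar_prod_def intro!: sum.cong)
    also have "\<dots> = (\<Sum>l=0..<b. P (f i) (g l) * Q (g l) (f j))"
      using lt by (intro sum.mono_neutral_cong_right) auto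
    also have "\<dots> = (\<Sum>c\<in>K. P (f i) c * Q c (f j))"
      using sum.reindex_bij_betw[OF g, of "\<lambda>c. P (f i) c * Q c (f j)"] by simp
    also have "\<dots> = 1\<^sub>m a $$ (i, j)"
      using inv[OF fij(1,2)] fij(3) ij by simp
    finally show "(?P * ?Q) $$ (i, j) = 1\<^sub>m a $$ (i, j)" .
  qed auto
  then have "det ?P * det ?Q = 1"
    using det_mult[of ?P a ?Q] by simp
  moreover have "det ?Q = 0"
  proof -
    have Q: "?Q = mat\<^sub>r a a (\<lambda>l. if l = b then 0\<^sub>v a else row ?Q l)"
      using lt by (intro eq_matI) auto
    show ?thesis
      by (subst Q, rule det_row_0[OF lt]) (auto intro!: row_carrier_vec)
  qed
  ultimately show False by simp
qed

lemma count_list_eq_card: "count_list xs j = card {r. r < length xs \<and> xs ! r = j}"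
  by (simp add: count_list_eq_length_filter length_filter_conv_card eq_commute)

text \<open>
  Modulo the maximal ideal a graded map is block diagonal, with one block for each degree.
\<close>

lemma degree_eq_if_const_coeff_nonzero:
  fixes A :: "('v::finite, 'k::field) mpol mat"
  assumes "graded_map ds es A" "r < length ds" "c < length es"
    and "Poly_Mapping.lookup (A $$ (r, c)) 0 \<noteq> 0"
  shows "ds ! r = es ! c"
proof -
  have "0 \<in> Poly_Mapping.keys (A $$ (r, c))"
    using assms(4) by (simp add: in_keys_iff)
  then have "mon_degree (0 :: 'v \<Rightarrow>\<^sub>0 nat) + ds ! r = es ! c"
    using assms(1-3) unfolding graded_map_def by blast
  then show ?thesis by (simp add: mon_degree_def)
qed

lemma graded_map_mult:
  assumes A: "graded_map ds es A" and B: "graded_map es fs B"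
  shows "graded_map ds fs (A * B)"
proof -
  have cA: "A \<in> carrier_mat (length ds) (length es)" and cB: "B \<in> carrier_mat (length es) (length fs)"
    using A B by (auto simp: graded_map_def)
  have "mon_degree m + ds ! r = fs ! c"
    if r: "r < length ds" and c: "c < length fs" and m: "m \<in> Poly_Mapping.keys ((A * B) $$ (r, c))" for r c m
  proof -
    have "(A * B) $$ (r, c) = (\<Sum>k<length es. A $$ (r, k) * B $$ (k, c))"
      using r c cA cB by (simp add: scalar_prod_def lessThan_atLeast0)
    then obtain k where k: "k < length es" "m \<in> Poly_Mapping.keys (A $$ (r, k) * B $$ (k, c))"
      using m keys_sum[of "\<lambda>k. A $$ (r, k) * B $$ (k, c)" "{..<length es}"] by auto
    then obtain s t where st: "m = s + t" "s \<in> Poly_Mapping.keys (A $$ (r, k))" "t \<in> Poly_Mapping.keys (B $$ (k, c))"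
      using keys_mult[of "A $$ (r, k)" "B $$ (k, c)"] by blast
    have "mon_degree s + ds ! r = es ! k" "mon_degree t + es ! k = fs ! c"
      using A B r c k(1) st(2,3) unfolding graded_map_def by blast+
    then show ?thesis using st(1) by (simp add: mon_degree_add)
  qed
  then show ?thesis using cA cB by (simp add: graded_map_def)
qed

lemma resolution_carrier:
  assumes "minimal_graded_free_resolution I d A"
  shows "A i \<in> carrier_mat (dim_row (A i)) (length (d i))"
proof (cases i)
  case 0
  have "graded_map [0] (d 0) (A 0)" using assms by (simp add: minimal_graded_free_resolution_def)
  then show ?thesis using 0 by (auto simp: graded_map_def)
next
  case (Suc j)
  have "graded_map (d j) (d (Suc j)) (A (Suc j))" using assms by (simp add: minimal_graded_free_resolution_def)
  then show ?thesis using Suc by (auto simp: graded_map_def)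
qed

lemma eq_one_add_diff:
  fixes X Y :: "'a::comm_ring_1 mat"
  assumes "X \<in> carrier_mat n n" "Y \<in> carrier_mat n n"
  shows "X = 1\<^sub>m n + (X - 1\<^sub>m n - Y) + Y"
  using assms by (intro eq_matI) auto

lemma col_in_image:
  assumes "X \<in> carrier_mat p q" "c < q"
  shows "col X c \<in> mat_image X"
proof -
  have "col X c = X *\<^sub>v unit_vec q c" using assms by (intro eq_vecI) auto
  then show ?thesis using assms by (auto simp: mat_image_def)
qed

text \<open>
  The definition of a resolution speaks of the entries of the one-dimensional vectors in the image
  of the augmentation, while lifting needs the vectors themselves.
\<close>

lemma image_eq_if_entries_eq:
  assumes X: "X \<in> carrier_mat 1 q" and Y: "Y \<in> carrier_mat 1 s"
    and eq: "(\<lambda>v. v $ 0) ` mat_image X = (\<lambda>v. v $ 0) ` mat_image Y"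
  shows "mat_image X = mat_image Y"
proof -
  have inj: "inj_on (\<lambda>v. v $ 0) (mat_image X \<union> mat_image Y)"
  proof (rule inj_onI)
    fix u v assume "u \<in> mat_image X \<union> mat_image Y" "v \<in> mat_image X \<union> mat_image Y" "u $ 0 = v $ 0"
    moreover have "dim_vec z = 1" if "z \<in> mat_image X \<union> mat_image Y" for z
      using that X Y unfolding mat_image_def by auto
    ultimately show "u = v" by (intro eq_vecI) auto
  qed
  show ?thesis
    using inj_on_image_eq_iff[OF inj, of "mat_image X" "mat_image Y"] eq by blast
qed

context
  fixes I :: "('v::finite, 'k::field) mpol set" and d d' A A'
  assumes R: "minimal_graded_free_resolution I d A"
    and R': "minimal_graded_free_resolution I d' A'"
begin

text \<open>
  The comparison theorem for two minimal resolutions, with the chain maps \<open>\<phi>\<close> and \<open>\<psi>\<close> and the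
  homotopy \<open>h\<close> from \<open>\<psi> \<circ> \<phi>\<close> to the identity constructed in one induction on the homological degree.
  The invariant records what the next step and the final comparison use: that \<open>\<phi>\<close> and \<open>\<psi>\<close> map cycles to cycles,
  and that the second homotopy term \<open>G\<close> (the composite of the differential with the previous
  homotopy) annihilates boundaries and vanishes modulo the maximal ideal. The latter is where
  minimality enters. In degree \<open>0\<close> the augmentation may have constant entries, but there \<open>G = 0\<close>.
\<close>

lemma comparison_up_to_homotopy:
  "\<exists>\<phi> \<psi> h G. graded_map (d' i) (d i) \<phi> \<and> graded_map (d i) (d' i) \<psi> \<and>
     h \<in> carrier_mat (length (d (Suc i))) (length (d i)) \<and>
     G \<in> carrier_mat (length (d i)) (length (d i)) \<and>
     A' i * \<phi> * A (Suc i) = 0\<^sub>m (dim_row (A' i)) (length (d (Suc i))) \<and>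
     A i * \<psi> * A' (Suc i) = 0\<^sub>m (dim_row (A i)) (length (d' (Suc i))) \<and>
     \<psi> * \<phi> = 1\<^sub>m (length (d i)) + A (Suc i) * h + G \<and>
     G * A (Suc i) = 0\<^sub>m (length (d i)) (length (d (Suc i))) \<and>
     const_coeff.mat_hom G = 0\<^sub>m (length (d i)) (length (d i))"
proof (induction i)
  case 0
  have gA: "graded_map [0] (d 0) (A 0)" and gA': "graded_map [0] (d' 0) (A' 0)"
    using R R' by (auto simp: minimal_graded_free_resolution_def)
  have cA: "A 0 \<in> carrier_mat 1 (length (d 0))" and cA': "A' 0 \<in> carrier_mat 1 (length (d' 0))"
    using gA gA' by (auto simp: graded_map_def)
  have cA1: "A 1 \<in> carrier_mat (length (d 0)) (length (d 1))"
    and cA1': "A' 1 \<in> carrier_mat (length (d' 0)) (length (d' 1))"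
    using R R' by (auto simp: minimal_graded_free_resolution_def graded_map_def)
  have ex: "mat_kernel (A 0) = mat_image (A 1)" and ex': "mat_kernel (A' 0) = mat_image (A' 1)"
    using R R' by (auto simp: minimal_graded_free_resolution_def)
  have same: "mat_image (A 0) = mat_image (A' 0)"
    using R R' by (intro image_eq_if_entries_eq[OF cA cA']) (simp add: minimal_graded_free_resolution_def)
  obtain \<phi> where \<phi>: "graded_map (d' 0) (d 0) \<phi>" "A' 0 * \<phi> = A 0"
    using graded_lift[OF gA' gA] col_in_image[OF cA] same by blast
  obtain \<psi> where \<psi>: "graded_map (d 0) (d' 0) \<psi>" "A 0 * \<psi> = A' 0"
    using graded_lift[OF gA gA'] col_in_image[OF cA'] same by blast
  have c\<phi>: "\<phi> \<in> carrier_mat (length (d' 0)) (length (d 0))"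
    and c\<psi>: "\<psi> \<in> carrier_mat (length (d 0)) (length (d' 0))"
    using \<phi>(1) \<psi>(1) by (auto simp: graded_map_def)
  have "A 0 * (\<psi> * \<phi> - 1\<^sub>m (length (d 0))) = A 0 * (\<psi> * \<phi>) - A 0 * 1\<^sub>m (length (d 0))"
    using cA c\<phi> c\<psi> by (intro mult_minus_distrib_mat) auto
  also have "A 0 * (\<psi> * \<phi>) = A 0"
    using assoc_mult_mat[OF cA c\<psi> c\<phi>] \<phi> \<psi> by simp
  finally have "A 0 * (\<psi> * \<phi> - 1\<^sub>m (length (d 0))) = 0\<^sub>m 1 (length (d 0))"
    using cA by simp
  moreover have "\<psi> * \<phi> - 1\<^sub>m (length (d 0)) \<in> carrier_mat (length (d 0)) (length (d 0))"
    by (rule minus_carrier_mat[OF one_carrier_mat])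
  ultimately obtain h where h: "h \<in> carrier_mat (length (d 1)) (length (d 0))"
      "A 1 * h = \<psi> * \<phi> - 1\<^sub>m (length (d 0))"
    using lift_through_kernel[OF ex cA cA1] by blast
  have AA: "A 0 * A 1 = 0\<^sub>m 1 (length (d 1))"
    by (rule mult_eq_0_if_image_subset_kernel[OF ex cA cA1])
  have AA': "A' 0 * A' 1 = 0\<^sub>m 1 (length (d' 1))"
    by (rule mult_eq_0_if_image_subset_kernel[OF ex' cA' cA1'])
  have "\<psi> * \<phi> = 1\<^sub>m (length (d 0)) + A 1 * h + 0\<^sub>m (length (d 0)) (length (d 0))"
    unfolding h(2) using c\<phi> c\<psi> by (intro eq_matI) auto
  moreover have "dim_row (A 0) = 1" "dim_row (A' 0) = 1" using cA cA' by auto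
  moreover have "const_coeff.mat_hom (0\<^sub>m (length (d 0)) (length (d 0))) = 0\<^sub>m (length (d 0)) (length (d 0))"
    by (intro eq_matI) auto
  moreover have "0\<^sub>m (length (d 0)) (length (d 0)) * A 1 = 0\<^sub>m (length (d 0)) (length (d 1))"
    using cA1 by simp
  ultimately show ?case
    unfolding One_nat_def[symmetric]
    by (intro exI[of _ \<phi>] exI[of _ \<psi>] exI[of _ h] exI[of _ "0\<^sub>m (length (d 0)) (length (d 0))"] conjI)
      (simp_all only: \<phi> \<psi> h(1) AA AA' zero_carrier_mat)
next
  case (Suc i)
  let ?n = "length (d i)" and ?n1 = "length (d (Suc i))" and ?n2 = "length (d (Suc (Suc i)))"
  let ?m = "length (d' i)" and ?m1 = "length (d' (Suc i))" and ?m2 = "length (d' (Suc (Suc i)))"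
  from Suc obtain \<phi> \<psi> h G where IH: "graded_map (d' i) (d i) \<phi>" "graded_map (d i) (d' i) \<psi>"
     "h \<in> carrier_mat ?n1 ?n" "G \<in> carrier_mat ?n ?n"
     "A' i * \<phi> * A (Suc i) = 0\<^sub>m (dim_row (A' i)) ?n1"
     "A i * \<psi> * A' (Suc i) = 0\<^sub>m (dim_row (A i)) ?m1"
     "\<psi> * \<phi> = 1\<^sub>m ?n + A (Suc i) * h + G"
     "G * A (Suc i) = 0\<^sub>m ?n ?n1"
    by blast
  have ex: "mat_kernel (A i) = mat_image (A (Suc i))" "mat_kernel (A' i) = mat_image (A' (Suc i))"
    "mat_kernel (A (Suc i)) = mat_image (A (Suc (Suc i)))" "mat_kernel (A' (Suc i)) = mat_image (A' (Suc (Suc i)))"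
    using R R' by (auto simp: minimal_graded_free_resolution_def)
  have gA1: "graded_map (d i) (d (Suc i)) (A (Suc i))" and gA1': "graded_map (d' i) (d' (Suc i)) (A' (Suc i))"
    using R R' by (auto simp: minimal_graded_free_resolution_def)
  have gA2: "graded_map (d (Suc i)) (d (Suc (Suc i))) (A (Suc (Suc i)))"
    and gA2': "graded_map (d' (Suc i)) (d' (Suc (Suc i))) (A' (Suc (Suc i)))"
    using R R' by (auto simp: minimal_graded_free_resolution_def)
  have cA: "A i \<in> carrier_mat (dim_row (A i)) ?n" and cA': "A' i \<in> carrier_mat (dim_row (A' i)) ?m"
    using resolution_carrier[OF R] resolution_carrier[OF R'] by blast+
  have cA1: "A (Suc i) \<in> carrier_mat ?n ?n1" and cA1': "A' (Suc i) \<in> carrier_mat ?m ?m1"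
    and cA2: "A (Suc (Suc i)) \<in> carrier_mat ?n1 ?n2" and cA2': "A' (Suc (Suc i)) \<in> carrier_mat ?m1 ?m2"
    using gA1 gA1' gA2 gA2' by (auto simp: graded_map_def)
  have c\<phi>: "\<phi> \<in> carrier_mat ?m ?n" and c\<psi>: "\<psi> \<in> carrier_mat ?n ?m"
    using IH(1,2) by (auto simp: graded_map_def)
  note g1 = graded_map_mult[OF IH(1) gA1] and g2 = graded_map_mult[OF IH(2) gA1']
  have "A' i * (\<phi> * A (Suc i)) = 0\<^sub>m (dim_row (A' i)) ?n1"
    using IH(5) assoc_mult_mat[OF cA' c\<phi> cA1] by simp
  note im1 = col_in_image_if_mult_0[OF ex(2) cA' mult_carrier_mat[OF c\<phi> cA1] this]
  obtain \<phi>' where \<phi>': "graded_map (d' (Suc i)) (d (Suc i)) \<phi>'" "A' (Suc i) * \<phi>' = \<phi> * A (Suc i)"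
    using graded_lift[OF gA1' g1 im1] .
  have "A i * (\<psi> * A' (Suc i)) = 0\<^sub>m (dim_row (A i)) ?m1"
    using IH(6) assoc_mult_mat[OF cA c\<psi> cA1'] by simp
  note im2 = col_in_image_if_mult_0[OF ex(1) cA mult_carrier_mat[OF c\<psi> cA1'] this]
  obtain \<psi>' where \<psi>': "graded_map (d (Suc i)) (d' (Suc i)) \<psi>'" "A (Suc i) * \<psi>' = \<psi> * A' (Suc i)"
    using graded_lift[OF gA1 g2 im2] .
  have c\<phi>': "\<phi>' \<in> carrier_mat ?m1 ?n1" and c\<psi>': "\<psi>' \<in> carrier_mat ?n1 ?m1"
    using \<phi>'(1) \<psi>'(1) by (auto simp: graded_map_def)
  have AA: "A (Suc i) * A (Suc (Suc i)) = 0\<^sub>m ?n ?n2"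
    by (rule mult_eq_0_if_image_subset_kernel[OF ex(3) cA1 cA2])
  have AA': "A' (Suc i) * A' (Suc (Suc i)) = 0\<^sub>m ?m ?m2"
    by (rule mult_eq_0_if_image_subset_kernel[OF ex(4) cA1' cA2'])
  \<comment> \<open>The columns of the defect ?N are cycles, hence of boundaries, since G annihilates the image of A (Suc i).\<close>
  let ?N = "\<psi>' * \<phi>' - 1\<^sub>m ?n1 - h * A (Suc i)"
  have hA: "h * A (Suc i) \<in> carrier_mat ?n1 ?n1" using IH(3) cA1 by simp
  have N: "?N \<in> carrier_mat ?n1 ?n1" by (rule minus_carrier_mat[OF hA])
  have "A (Suc i) * (\<psi>' * \<phi>') = \<psi> * \<phi> * A (Suc i)"
    using assoc_mult_mat[OF cA1 c\<psi>' c\<phi>'] assoc_mult_mat[OF c\<psi> c\<phi> cA1]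
      assoc_mult_mat[OF c\<psi> cA1' c\<phi>'] \<phi>' \<psi>' by simp
  also have "\<dots> = A (Suc i) + A (Suc i) * h * A (Suc i) + 0\<^sub>m ?n ?n1"
    unfolding IH(7) using IH(3,4,8) cA1
    by (subst add_mult_distrib_mat[of _ ?n ?n _ _ ?n1], auto, subst add_mult_distrib_mat[of _ ?n ?n _ _ ?n1], auto)
  finally have AN: "A (Suc i) * (\<psi>' * \<phi>') = A (Suc i) + A (Suc i) * (h * A (Suc i))"
    using assoc_mult_mat[OF cA1 IH(3) cA1] IH(3) cA1 by simp
  have "A (Suc i) * ?N = A (Suc i) * (\<psi>' * \<phi>') - A (Suc i) - A (Suc i) * (h * A (Suc i))"
    using cA1 c\<phi>' c\<psi>' hA
    by (subst mult_minus_distrib_mat[of _ ?n ?n1 _ ?n1], auto, subst mult_minus_distrib_mat[of _ ?n ?n1 _ ?n1], auto)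
  also have "\<dots> = 0\<^sub>m ?n ?n1"
    unfolding AN using cA1 hA by (intro eq_matI) auto
  finally obtain h' where h': "h' \<in> carrier_mat ?n2 ?n1" "A (Suc (Suc i)) * h' = ?N"
    by (rule lift_through_kernel[OF ex(3) cA1 cA2 N])
  have "\<psi>' * \<phi>' = 1\<^sub>m ?n1 + A (Suc (Suc i)) * h' + h * A (Suc i)"
    unfolding h'(2) by (rule eq_one_add_diff[OF mult_carrier_mat[OF c\<psi>' c\<phi>'] hA])
  moreover have "h * A (Suc i) * A (Suc (Suc i)) = 0\<^sub>m ?n1 ?n2"
    using assoc_mult_mat[OF IH(3) cA1 cA2] AA IH(3) by simp
  moreover have "const_coeff.mat_hom (h * A (Suc i)) = 0\<^sub>m ?n1 ?n1"
  proof -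
    have "const_coeff.mat_hom (A (Suc i)) = 0\<^sub>m ?n ?n1"
      using R cA1 by (intro eq_matI) (auto simp: minimal_graded_free_resolution_def)
    then show ?thesis
      using const_coeff.mat_hom_mult[OF IH(3) cA1] IH(3) by simp
  qed
  moreover have "A' (Suc i) * \<phi>' * A (Suc (Suc i)) = 0\<^sub>m ?m ?n2"
    unfolding \<phi>'(2) using assoc_mult_mat[OF c\<phi> cA1 cA2] AA c\<phi> by simp
  moreover have "A (Suc i) * \<psi>' * A' (Suc (Suc i)) = 0\<^sub>m ?n ?m2"
    unfolding \<psi>'(2) using assoc_mult_mat[OF c\<psi> cA1' cA2'] AA' c\<psi> by simp
  moreover have "dim_row (A' (Suc i)) = ?m" "dim_row (A (Suc i)) = ?n" using cA1 cA1' by auto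
  ultimately show ?case
    by (intro exI[of _ \<phi>'] exI[of _ \<psi>'] exI[of _ h'] exI[of _ "h * A (Suc i)"] conjI)
      (simp_all only: \<phi>'(1) \<psi>'(1) h'(1) hA)
qed

text \<open>
  Modulo the maximal ideal both homotopy terms vanish, so \<open>\<psi>\<close> is a left inverse of \<open>\<phi>\<close>, and this
  holds within the block of each degree.
\<close>

lemma count_degree_le: "count_list (d i) j \<le> count_list (d' i) j"
proof -
  let ?n = "length (d i)" and ?n1 = "length (d (Suc i))" and ?m = "length (d' i)"
  obtain \<phi> \<psi> h G where H: "graded_map (d' i) (d i) \<phi>" "graded_map (d i) (d' i) \<psi>"
     "h \<in> carrier_mat ?n1 ?n" "G \<in> carrier_mat ?n ?n" 
     "\<psi> * \<phi> = 1\<^sub>m ?n + A (Suc i) * h + G"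
     "const_coeff.mat_hom G = 0\<^sub>m ?n ?n"
    using comparison_up_to_homotopy[of i] by blast
  have c\<phi>: "\<phi> \<in> carrier_mat ?m ?n" and c\<psi>: "\<psi> \<in> carrier_mat ?n ?m"
    using H(1,2) by (auto simp: graded_map_def)
  have cA1: "A (Suc i) \<in> carrier_mat ?n ?n1"
    using R by (auto simp: minimal_graded_free_resolution_def graded_map_def)
  let ?c = "\<lambda>p :: ('v, 'k) mpol. Poly_Mapping.lookup p 0"
  have "const_coeff.mat_hom (A (Suc i)) = 0\<^sub>m ?n ?n1"
    using R cA1 by (intro eq_matI) (auto simp: minimal_graded_free_resolution_def)
  then have Ah: "const_coeff.mat_hom (A (Suc i) * h) = 0\<^sub>m ?n ?n"
    using const_coeff.mat_hom_mult[OF cA1 H(3)] H(3) by simp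
  have one: "?c ((\<psi> * \<phi>) $$ (r, s)) = (if r = s then 1 else 0)" if "r < ?n" "s < ?n" for r s
  proof -
    have "?c (G $$ (r, s)) = 0"
      using arg_cong[OF H(6), of "\<lambda>M. M $$ (r, s)"] that H(4) by simp
    moreover have "?c ((A (Suc i) * h) $$ (r, s)) = 0"
      using arg_cong[OF Ah, of "\<lambda>M. M $$ (r, s)"] that cA1 H(3) by simp
    moreover have "(\<psi> * \<phi>) $$ (r, s) = (if r = s then 1 else 0) + (A (Suc i) * h) $$ (r, s) + G $$ (r, s)"
      unfolding H(5) using that cA1 H(3,4) by simp
    ultimately show ?thesis by (simp add: lookup_add)
  qed
  show ?thesis
    unfolding count_list_eq_card
  proof (rule card_le_if_one_sided_inverse)
    fix r s assume "r \<in> {r. r < ?n \<and> d i ! r = j}" "s \<in> {r. r < ?n \<and> d i ! r = j}"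
    then have rs: "r < ?n" "s < ?n" "d i ! r = j" "d i ! s = j" by auto
    have "(\<Sum>c\<in>{c. c < ?m \<and> d' i ! c = j}. ?c (\<psi> $$ (r, c)) * ?c (\<phi> $$ (c, s)))
        = (\<Sum>c=0..<?m. ?c (\<psi> $$ (r, c)) * ?c (\<phi> $$ (c, s)))"
    proof (rule sum.mono_neutral_left)
      show "\<forall>c\<in>{0..<?m} - {c. c < ?m \<and> d' i ! c = j}. ?c (\<psi> $$ (r, c)) * ?c (\<phi> $$ (c, s)) = 0"
        using degree_eq_if_const_coeff_nonzero[OF H(2) rs(1)] rs(3) by fastforce
    qed auto
    also have "\<dots> = ?c ((\<psi> * \<phi>) $$ (r, s))"
      using c\<phi> c\<psi> rs(1,2) by (simp add: scalar_prod_def lookup_sum const_coeff_mult)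
    finally show "(\<Sum>c\<in>{c. c < ?m \<and> d' i ! c = j}. ?c (\<psi> $$ (r, c)) * ?c (\<phi> $$ (c, s)))
        = (if r = s then 1 else 0)"
      using one rs by simp
  qed auto
qed

end

lemma graded_betti_eq_count:
  assumes "minimal_graded_free_resolution I d A"
  shows "graded_betti I i j = count_list (d i) j"
  unfolding graded_betti_def
proof (rule the_equality)
  show "\<exists>d' A'. minimal_graded_free_resolution I d' A' \<and> count_list (d i) j = count_list (d' i) j"
    using assms by blast
next
  fix b assume "\<exists>d' A'. minimal_graded_free_resolution I d' A' \<and> b = count_list (d' i) j"
  then show "b = count_list (d i) j"
    using count_degree_le[OF assms] count_degree_le[OF _ assms] by (metis le_antisym)
qed

section \<open>The Koszul complex\<close>

interpretation ideal: Modules.module "(*) :: 'a::comm_ring_1 \<Rightarrow> 'a \<Rightarrow> 'a"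
  by standard (simp_all add: algebra_simps)

text \<open>
  The recursion on lists adds a new element at the front, so each entry is a nonzerodivisor modulo
  the entries to its right.
\<close>

fun regular_sequence :: "'a::comm_ring_1 list \<Rightarrow> bool" where
  "regular_sequence [] = True"
| "regular_sequence (f # fs) \<longleftrightarrow>
     regular_sequence fs \<and> (\<forall>g. g * f \<in> ideal.span (set fs) \<longrightarrow> g \<in> ideal.span (set fs))"

text \<open>
  The differential of the mapping cone of multiplication by \<open>s\<close> (up to sign) on a complex in which
  \<open>A\<close> is followed by \<open>B\<close>: in block form it is \<open>(u, v) \<mapsto> (A u + s v, B v)\<close>.
\<close>

definition cone_mat :: "'a::comm_ring_1 \<Rightarrow> 'a mat \<Rightarrow> 'a mat \<Rightarrow> 'a mat" where
  "cone_mat s A B = four_block_mat A (s \<cdot>\<^sub>m 1\<^sub>m (dim_row A)) (0\<^sub>m (dim_row B) (dim_col A)) B"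

lemma smult_mat_mult_vec:
  fixes A :: "'a::comm_ring_1 mat"
  assumes "A \<in> carrier_mat p q" "v \<in> carrier_vec q"
  shows "(h \<cdot>\<^sub>m A) *\<^sub>v v = h \<cdot>\<^sub>v (A *\<^sub>v v)"
  using assms by (intro eq_vecI) auto

lemma mat_mult_smult_vec:
  fixes A :: "'a::comm_ring_1 mat"
  assumes "A \<in> carrier_mat p q" "v \<in> carrier_vec q"
  shows "A *\<^sub>v (h \<cdot>\<^sub>v v) = h \<cdot>\<^sub>v (A *\<^sub>v v)"
  using assms by (intro eq_vecI) auto

lemma zero_vec_append: "0\<^sub>v a @\<^sub>v 0\<^sub>v p = (0\<^sub>v (a + p) :: 'a::zero vec)"
  by (intro eq_vecI) auto

lemma zero_mult_vec: "v \<in> carrier_vec b \<Longrightarrow> 0\<^sub>m p b *\<^sub>v v = (0\<^sub>v p :: 'a::comm_ring_1 vec)"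
  by (intro eq_vecI) auto

lemma mat_image_eq: "A \<in> carrier_mat p q \<Longrightarrow> mat_image A = (\<lambda>v. A *\<^sub>v v) ` carrier_vec q"
  by (auto simp: mat_image_def)

lemma in_mat_imageI: "A \<in> carrier_mat p q \<Longrightarrow> v \<in> carrier_vec q \<Longrightarrow> A *\<^sub>v v \<in> mat_image A"
  by (auto simp: mat_image_def)

lemma cone_mat_carrier:
  assumes "A \<in> carrier_mat a b" "B \<in> carrier_mat p a"
  shows "cone_mat s A B \<in> carrier_mat (a + p) (b + a)"
  using assms unfolding cone_mat_def by auto

lemma cone_mat_mult_vec:
  assumes A: "A \<in> carrier_mat a b" and B: "B \<in> carrier_mat p a"
    and u: "u \<in> carrier_vec b" and v: "v \<in> carrier_vec a"
  shows "cone_mat s A B *\<^sub>v (u @\<^sub>v v) = (A *\<^sub>v u + s \<cdot>\<^sub>v v) @\<^sub>v (B *\<^sub>v v)"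
proof -
  have z: "0\<^sub>m p b *\<^sub>v u = 0\<^sub>v p"
    by (rule zero_mult_vec[OF u])
  have "(s \<cdot>\<^sub>m 1\<^sub>m a) *\<^sub>v v = s \<cdot>\<^sub>v v"
    using v smult_mat_mult_vec[of "1\<^sub>m a" a a v s] by simp
  moreover have "cone_mat s A B *\<^sub>v (u @\<^sub>v v) =
      (A *\<^sub>v u + (s \<cdot>\<^sub>m 1\<^sub>m a) *\<^sub>v v) @\<^sub>v (0\<^sub>m p b *\<^sub>v u + B *\<^sub>v v)"
    using four_block_mat_mult_vec[OF A _ _ B u v, of "s \<cdot>\<^sub>m 1\<^sub>m a" "0\<^sub>m p b"] A B
    by (simp add: cone_mat_def)
  ultimately show ?thesis
    using z B v by simp
qed

text \<open>
  If \<open>A u + s v = 0\<close> and \<open>B v = 0\<close>, write \<open>v = A y\<close>; then \<open>u + s y\<close> is a cycle, hence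
  \<open>u + s y = C x\<close>, and \<open>(u, v)\<close> is the image of \<open>(x, y)\<close>. The existence of \<open>y\<close> is left as a
  hypothesis: it comes from exactness one degree lower, except at the bottom of the complex, where
  it comes from \<open>s\<close> being a nonzerodivisor.
\<close>

lemma cone_mat_exact:
  assumes A: "A \<in> carrier_mat a b" and B: "B \<in> carrier_mat p a" and C: "C \<in> carrier_mat b c"
    and ex: "mat_kernel A = mat_image C" and BA: "B * A = 0\<^sub>m p b"
    and lift: "\<And>u v. u \<in> carrier_vec b \<Longrightarrow> v \<in> carrier_vec a \<Longrightarrow>
       A *\<^sub>v u + s \<cdot>\<^sub>v v = 0\<^sub>v a \<Longrightarrow> B *\<^sub>v v = 0\<^sub>v p \<Longrightarrow> v \<in> mat_image A"
  shows "mat_kernel (cone_mat s A B) = mat_image (cone_mat (- s) C A)"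
proof
  have cAB: "cone_mat s A B \<in> carrier_mat (a + p) (b + a)"
    and cCA: "cone_mat (- s) C A \<in> carrier_mat (b + a) (c + b)"
    by (rule cone_mat_carrier[OF A B], rule cone_mat_carrier[OF C A])
  show "mat_kernel (cone_mat s A B) \<subseteq> mat_image (cone_mat (- s) C A)"
  proof
    fix z assume "z \<in> mat_kernel (cone_mat s A B)"
    then have z: "z \<in> carrier_vec (b + a)" "cone_mat s A B *\<^sub>v z = 0\<^sub>v (a + p)"
      using mat_kernelD[OF cAB] by auto
    define u v where "u = vec_first z b" and "v = vec_last z a"
    have uv: "u \<in> carrier_vec b" "v \<in> carrier_vec a" "z = u @\<^sub>v v"
      using z(1) by (auto simp: u_def v_def)
    have "(A *\<^sub>v u + s \<cdot>\<^sub>v v) @\<^sub>v (B *\<^sub>v v) = 0\<^sub>v a @\<^sub>v 0\<^sub>v p"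
      using z(2) unfolding uv(3) cone_mat_mult_vec[OF A B uv(1,2)]
      unfolding zero_vec_append .
    moreover have sv: "s \<cdot>\<^sub>v v \<in> carrier_vec a"
      using uv(2) by simp
    ultimately have uv0: "A *\<^sub>v u + s \<cdot>\<^sub>v v = 0\<^sub>v a" "B *\<^sub>v v = 0\<^sub>v p"
      using append_vec_eq[OF add_carrier_vec[OF mult_mat_vec_carrier[OF A uv(1)] sv] zero_carrier_vec]
      by blast+
    have "v \<in> mat_image A"
      by (rule lift[OF uv(1,2) uv0])
    then obtain y where y: "y \<in> carrier_vec b" "v = A *\<^sub>v y"
      unfolding mat_image_def carrier_matD(2)[OF A] by blast
    have sy: "s \<cdot>\<^sub>v y \<in> carrier_vec b"
      using y(1) by simp
    have "A *\<^sub>v (u + s \<cdot>\<^sub>v y) = A *\<^sub>v u + s \<cdot>\<^sub>v (A *\<^sub>v y)"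
      unfolding mult_add_distrib_mat_vec[OF A uv(1) sy] mat_mult_smult_vec[OF A y(1)] ..
    also have "\<dots> = 0\<^sub>v a"
      using uv0(1) unfolding y(2) .
    finally have "A *\<^sub>v (u + s \<cdot>\<^sub>v y) = 0\<^sub>v a" .
    then have "u + s \<cdot>\<^sub>v y \<in> mat_image C"
      using mat_kernelI[OF A add_carrier_vec[OF uv(1) sy]] unfolding ex by blast
    then obtain x where x: "x \<in> carrier_vec c" "u + s \<cdot>\<^sub>v y = C *\<^sub>v x"
      unfolding mat_image_def carrier_matD(2)[OF C] by blast
    have "u = C *\<^sub>v x + (- s) \<cdot>\<^sub>v y"
      unfolding x(2)[symmetric] using uv(1) y(1) by (intro eq_vecI) auto
    then have "z = cone_mat (- s) C A *\<^sub>v (x @\<^sub>v y)"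
      unfolding cone_mat_mult_vec[OF C A x(1) y(1)] uv(3) y(2) by simp
    then show "z \<in> mat_image (cone_mat (- s) C A)"
      using in_mat_imageI[OF cCA append_carrier_vec[OF x(1) y(1)]] by simp
  qed
  show "mat_image (cone_mat (- s) C A) \<subseteq> mat_kernel (cone_mat s A B)"
  proof
    fix z assume "z \<in> mat_image (cone_mat (- s) C A)"
    then obtain t where t: "t \<in> carrier_vec (c + b)" "z = cone_mat (- s) C A *\<^sub>v t"
      unfolding mat_image_def carrier_matD(2)[OF cCA] by blast
    define x y where "x = vec_first t c" and "y = vec_last t b"
    have xy: "x \<in> carrier_vec c" "y \<in> carrier_vec b" "t = x @\<^sub>v y"
      using t(1) by (auto simp: x_def y_def)
    have z: "z = (C *\<^sub>v x + (- s) \<cdot>\<^sub>v y) @\<^sub>v (A *\<^sub>v y)"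
      unfolding t(2) xy(3) by (rule cone_mat_mult_vec[OF C A xy(1,2)])
    have "C *\<^sub>v x \<in> mat_kernel A"
      unfolding ex by (rule in_mat_imageI[OF C xy(1)])
    then have ACx: "A *\<^sub>v (C *\<^sub>v x) = 0\<^sub>v a"
      using mat_kernelD[OF A] by blast
    have Cx: "C *\<^sub>v x \<in> carrier_vec b" and sy: "(- s) \<cdot>\<^sub>v y \<in> carrier_vec b"
      and Ay: "A *\<^sub>v y \<in> carrier_vec a"
      using A C xy(1,2) by auto
    have "A *\<^sub>v (C *\<^sub>v x + (- s) \<cdot>\<^sub>v y) + s \<cdot>\<^sub>v (A *\<^sub>v y) = (0\<^sub>v a + (- s) \<cdot>\<^sub>v (A *\<^sub>v y)) + s \<cdot>\<^sub>v (A *\<^sub>v y)"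
      unfolding mult_add_distrib_mat_vec[OF A Cx sy] mat_mult_smult_vec[OF A xy(2)] ACx ..
    also have "\<dots> = 0\<^sub>v a"
      using carrier_vecD[OF Ay] by (intro eq_vecI) simp_all
    finally have first: "A *\<^sub>v (C *\<^sub>v x + (- s) \<cdot>\<^sub>v y) + s \<cdot>\<^sub>v (A *\<^sub>v y) = 0\<^sub>v a" .
    have "B *\<^sub>v (A *\<^sub>v y) = 0\<^sub>v p"
      using assoc_mult_mat_vec[OF B A xy(2)] BA zero_mult_vec[OF xy(2), of p] by metis
    then have "cone_mat s A B *\<^sub>v z = 0\<^sub>v a @\<^sub>v 0\<^sub>v p"
      unfolding z cone_mat_mult_vec[OF A B add_carrier_vec[OF Cx sy] Ay] first by simp
    then have "cone_mat s A B *\<^sub>v z = 0\<^sub>v (a + p)"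
      unfolding zero_vec_append .
    moreover have "z \<in> carrier_vec (b + a)"
      unfolding z by (intro append_carrier_vec add_carrier_vec Cx sy Ay)
    ultimately show "z \<in> mat_kernel (cone_mat s A B)"
      using mat_kernelI[OF cAB] by blast
  qed
qed

text \<open>
  The Koszul complex of \<open>f # fs\<close> is the cone of multiplication by \<open>f\<close> on the Koszul complex of
  \<open>fs\<close>; the alternating sign makes consecutive maps compose to zero. The map with index \<open>Suc 0\<close> is
  the row of the elements of the list (in reverse order); the map with index \<open>0\<close> goes from the ring to the zero module,
  so that the cone construction is uniform.
\<close>

fun koszul_map :: "'a::comm_ring_1 list \<Rightarrow> nat \<Rightarrow> 'a mat" where
  "koszul_map [] 0 = 0\<^sub>m 0 1"
| "koszul_map [] (Suc 0) = 0\<^sub>m 1 0"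
| "koszul_map [] (Suc (Suc i)) = 0\<^sub>m 0 0"
| "koszul_map (f # fs) 0 = koszul_map fs 0"
| "koszul_map (f # fs) (Suc i) = cone_mat ((- 1) ^ i * f) (koszul_map fs (Suc i)) (koszul_map fs i)"

lemma koszul_map_0: "koszul_map fs 0 = 0\<^sub>m 0 1"
  by (induction fs) auto

lemma koszul_map_carrier:
  "koszul_map fs (Suc i) \<in> carrier_mat (length fs choose i) (length fs choose Suc i)"
proof (induction fs arbitrary: i)
  case Nil
  then show ?case by (cases i) auto
next
  case (Cons f fs)
  show ?case
  proof (cases i)
    case 0
    then show ?thesis
      using cone_mat_carrier[OF Cons.IH[of 0], of "koszul_map fs 0" 0] by (simp add: koszul_map_0)
  next
    case (Suc j)
    then show ?thesis
      using cone_mat_carrier[OF Cons.IH[of i], of "koszul_map fs i"] Cons.IH[of j] by (simp add: add.commute)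
  qed
qed

lemma image_cone_entries:
  assumes A: "A \<in> carrier_mat 1 b"
  shows "(\<lambda>v. v $ 0) ` mat_image (cone_mat f A (0\<^sub>m 0 1)) = {y + g * f | y g. y \<in> (\<lambda>v. v $ 0) ` mat_image A}"
    (is "?L = ?R")
proof -
  have c: "cone_mat f A (0\<^sub>m 0 1) \<in> carrier_mat (1 + 0) (b + 1)"
    by (rule cone_mat_carrier[OF A]) simp
  have ev: "(cone_mat f A (0\<^sub>m 0 1) *\<^sub>v (u @\<^sub>v v)) $ 0 = (A *\<^sub>v u) $ 0 + v $ 0 * f"
    if "u \<in> carrier_vec b" "v \<in> carrier_vec 1" for u v
    using cone_mat_mult_vec[OF A _ that, of "0\<^sub>m 0 1" 0 f] that A by (simp add: mult.commute)
  show ?thesis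
  proof
    show "?L \<subseteq> ?R"
    proof
      fix x assume "x \<in> ?L"
      then obtain z where z: "z \<in> carrier_vec (b + 1)" "x = (cone_mat f A (0\<^sub>m 0 1) *\<^sub>v z) $ 0"
        using c by (auto simp: mat_image_def)
      have z': "vec_first z b @\<^sub>v vec_last z 1 = z"
        using z(1) by simp
      have "x = (A *\<^sub>v vec_first z b) $ 0 + vec_last z 1 $ 0 * f"
        unfolding z(2) using ev[of "vec_first z b" "vec_last z 1"] unfolding z' by simp
      moreover have "A *\<^sub>v vec_first z b \<in> mat_image A"
        using A by (auto simp: mat_image_def)
      ultimately show "x \<in> ?R" by blast
    qed
    show "?R \<subseteq> ?L"
    proof
      fix x assume "x \<in> ?R"
      then obtain u g where u: "u \<in> carrier_vec b" "x = (A *\<^sub>v u) $ 0 + g * f"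
        using A by (auto simp: mat_image_def)
      have "x = (cone_mat f A (0\<^sub>m 0 1) *\<^sub>v (u @\<^sub>v vec 1 (\<lambda>_. g))) $ 0"
        using ev[OF u(1), of "vec 1 (\<lambda>_. g)"] u(2) by simp
      moreover have "u @\<^sub>v vec 1 (\<lambda>_. g) \<in> carrier_vec (b + 1)"
        by (intro append_carrier_vec u(1) vec_carrier)
      ultimately show "x \<in> ?L"
        using in_mat_imageI[of "cone_mat f A (0\<^sub>m 0 1)" _ "b + 1"] c by blast
    qed
  qed
qed

lemma koszul_augmentation:
  "(\<lambda>v. v $ 0) ` mat_image (koszul_map fs (Suc 0)) = ideal.span (set fs)"
proof (induction fs)
  case Nil
  have "0\<^sub>m 1 0 *\<^sub>v v = (0\<^sub>v 1 :: 'a vec)" if "v \<in> carrier_vec 0" for v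
    using that by (intro eq_vecI) (auto simp: scalar_prod_def)
  then have "mat_image (0\<^sub>m 1 0) = {0\<^sub>v 1 :: 'a vec}"
    by (auto simp: mat_image_def intro!: exI[of _ "0\<^sub>v 0"])
  then show ?case by simp
next
  case (Cons f fs)
  have A: "koszul_map fs (Suc 0) \<in> carrier_mat 1 (length fs)"
    using koszul_map_carrier[of fs 0] by simp
  have "(\<lambda>v. v $ 0) ` mat_image (koszul_map (f # fs) (Suc 0)) = {y + g * f | y g. y \<in> ideal.span (set fs)}"
    using image_cone_entries[OF A, of f] by (simp add: koszul_map_0 Cons.IH)
  also have "\<dots> = ideal.span (set (f # fs))"
  proof -
    have "y + g * f - g * f \<in> ideal.span (set fs)" if "y \<in> ideal.span (set fs)" for y g
      using that by simp
    moreover have "x = (x - k * f) + k * f" for x k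
      by simp
    ultimately show ?thesis
      unfolding list.set ideal.span_insert by blast
  qed
  finally show ?case .
qed

text \<open>
  By induction on the list, using exactness of the cone. In the lowest degree a relation
  \<open>A u + f v = 0\<close> says that \<open>v f\<close> lies in the ideal generated by \<open>fs\<close>; regularity puts \<open>v\<close> itself
  into that ideal, which is the image of \<open>A\<close>.
\<close>

lemma koszul_exact:
  assumes "regular_sequence fs"
  shows "mat_kernel (koszul_map fs (Suc i)) = mat_image (koszul_map fs (Suc (Suc i)))"
  using assms
proof (induction fs arbitrary: i)
  case Nil
  have 0: "(v :: 'a vec) = 0\<^sub>v 0" if "v \<in> carrier_vec 0" for v
    using that by (intro eq_vecI) auto
  have "mat_kernel (0\<^sub>m p 0) = {0\<^sub>v 0 :: 'a vec}" for p
    using 0 by (auto simp: mat_kernel_def intro!: eq_vecI)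
  moreover have "mat_image (0\<^sub>m 0 0) = {0\<^sub>v 0 :: 'a vec}"
    by (auto simp: mat_image_def intro!: exI[of _ "0\<^sub>v 0"] eq_vecI)
  ultimately show ?case by (cases i) simp_all
next
  case (Cons f fs)
  let ?A = "koszul_map fs (Suc i)" and ?B = "koszul_map fs i" and ?C = "koszul_map fs (Suc (Suc i))"
  let ?s = "(- 1) ^ i * f"
  have ex: "mat_kernel (koszul_map fs (Suc i)) = mat_image (koszul_map fs (Suc (Suc i)))" for i
    using Cons by simp
  have A: "?A \<in> carrier_mat (length fs choose i) (length fs choose Suc i)"
    and C: "?C \<in> carrier_mat (length fs choose Suc i) (length fs choose Suc (Suc i))"
    by (rule koszul_map_carrier)+
  have "mat_kernel (cone_mat ?s ?A ?B) = mat_image (cone_mat (- ?s) ?C ?A)"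
  proof (cases i)
    case 0
    have A0: "?A \<in> carrier_mat 1 (length fs)" using A 0 by simp
    have B0: "?B = 0\<^sub>m 0 1" using 0 by (simp add: koszul_map_0)
    show ?thesis
    proof (rule cone_mat_exact[OF A0 _ _ ex])
      show "?B \<in> carrier_mat 0 1" "?B * ?A = 0\<^sub>m 0 (length fs)"
        using A0 by (auto simp: B0)
      show "?C \<in> carrier_mat (length fs) (length fs choose Suc (Suc i))"
        using C 0 by simp
      fix u v assume u: "u \<in> carrier_vec (length fs)" and v: "v \<in> carrier_vec 1"
        and eq: "?A *\<^sub>v u + ?s \<cdot>\<^sub>v v = 0\<^sub>v 1"
      have span: "(\<lambda>v. v $ 0) ` mat_image ?A = ideal.span (set fs)"
        using koszul_augmentation[of fs] 0 by simp
      have "(?A *\<^sub>v u) $ 0 + v $ 0 * f = 0"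
        using arg_cong[OF eq, of "\<lambda>v. v $ 0"] v A0 0 by (simp add: mult.commute)
      then have "v $ 0 * f = - (?A *\<^sub>v u) $ 0"
        by (simp add: eq_neg_iff_add_eq_0 add.commute)
      moreover have "(?A *\<^sub>v u) $ 0 \<in> ideal.span (set fs)"
        unfolding span[symmetric] using u A0 by (intro imageI) (auto simp: mat_image_def)
      ultimately have "v $ 0 * f \<in> ideal.span (set fs)"
        using A0 by (simp add: ideal.span_neg)
      then have "v $ 0 \<in> (\<lambda>v. v $ 0) ` mat_image ?A"
        using Cons.prems span by simp
      then obtain y where y: "y \<in> mat_image ?A" "v $ 0 = y $ 0" by blast
      then have "v = y"
        using v A0 by (intro eq_vecI) (auto simp: mat_image_def)
      then show "v \<in> mat_image ?A" using y(1) by simp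
    qed
  next
    case (Suc j)
    have B: "?B \<in> carrier_mat (length fs choose j) (length fs choose i)"
      unfolding Suc by (rule koszul_map_carrier)
    have exB: "mat_kernel ?B = mat_image ?A"
      unfolding Suc by (rule ex)
    show ?thesis
    proof (rule cone_mat_exact[OF A B C ex])
      show "?B * ?A = 0\<^sub>m (length fs choose j) (length fs choose Suc i)"
        by (rule mult_eq_0_if_image_subset_kernel[OF exB B A])
      show "v \<in> mat_image ?A" if "v \<in> carrier_vec (length fs choose i)" "?B *\<^sub>v v = 0\<^sub>v (length fs choose j)" for v
        using mat_kernelI[OF B that] exB by simp
    qed
  qed
  then show ?case by simp
qed

text \<open>
  The degrees of the basis vectors of the Koszul complex in each homological degree, if the elements
  of the sequence have the degrees \<open>es\<close>: these are the sums over the subsets of size \<open>i\<close>, in the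
  order in which the cone lists them.
\<close>

fun koszul_degrees :: "nat list \<Rightarrow> nat \<Rightarrow> nat list" where
  "koszul_degrees [] 0 = [0]"
| "koszul_degrees [] (Suc i) = []"
| "koszul_degrees (e # es) 0 = koszul_degrees es 0"
| "koszul_degrees (e # es) (Suc i) = koszul_degrees es (Suc i) @ map (\<lambda>j. j + e) (koszul_degrees es i)"

lemma koszul_degrees_0: "koszul_degrees es 0 = [0]"
  by (induction es) auto

lemma length_koszul_degrees: "length (koszul_degrees es i) = length es choose i"
  by (induction es i rule: koszul_degrees.induct) auto

text \<open>
  A sum over \<open>i\<close> of the positive degrees \<open>es\<close> omits \<open>length es - i\<close> of them, each at least \<open>1\<close>.
  So \<open>j - i\<close> is largest for the full sum.
\<close>

lemma koszul_degrees_bound: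
  assumes "\<forall>e\<in>set es. 1 \<le> e" "j \<in> set (koszul_degrees es i)"
  shows "j + length es \<le> sum_list es + i"
  using assms by (induction es i arbitrary: j rule: koszul_degrees.induct) (fastforce simp: koszul_degrees_0)+

lemma koszul_degrees_top: "koszul_degrees es (length es) = [sum_list es]"
proof (induction es)
  case (Cons e es)
  have "koszul_degrees es (Suc (length es)) = []"
    using length_koszul_degrees[of es "Suc (length es)"] by (simp add: binomial_eq_0)
  then show ?case using Cons by simp
qed simp

text \<open>
  The alternative for \<open>B\<close> covers the bottom of the complex, where \<open>B\<close> is the map to the zero module.
\<close>

lemma graded_map_cone:
  assumes A: "graded_map ds es A" and B: "graded_map cs ds B \<or> B = 0\<^sub>m 0 (length ds) \<and> cs = []"
    and s: "\<forall>m\<in>Poly_Mapping.keys s. mon_degree m = e"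
  shows "graded_map (ds @ map (\<lambda>j. j + e) cs) (es @ map (\<lambda>j. j + e) ds) (cone_mat s A B)"
proof -
  have cA: "A \<in> carrier_mat (length ds) (length es)" and cB: "B \<in> carrier_mat (length cs) (length ds)"
    using A B by (auto simp: graded_map_def)
  have dA: "mon_degree m + ds ! r = es ! c"
    if "r < length ds" "c < length es" "m \<in> Poly_Mapping.keys (A $$ (r, c))" for r c m
    using A that by (auto simp: graded_map_def)
  have dB: "mon_degree m + cs ! r = ds ! c"
    if "r < length cs" "c < length ds" "m \<in> Poly_Mapping.keys (B $$ (r, c))" for r c m
    using B that by (auto simp: graded_map_def)
  have "mon_degree m + (ds @ map (\<lambda>j. j + e) cs) ! r = (es @ map (\<lambda>j. j + e) ds) ! c"
    if r: "r < length ds + length cs" and c: "c < length es + length ds"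
      and m: "m \<in> Poly_Mapping.keys (cone_mat s A B $$ (r, c))" for r c m
  proof -
    have ent: "cone_mat s A B $$ (r, c) =
      (if r < length ds then
         if c < length es then A $$ (r, c) else if r = c - length es then s else 0
       else if c < length es then 0 else B $$ (r - length ds, c - length es))"
      using r c cA cB by (auto simp: cone_mat_def)
    consider "r < length ds" "c < length es" | "r < length ds" "\<not> c < length es" | "\<not> r < length ds" by blast
    then show ?thesis
    proof cases
      case 1
      then show ?thesis using dA[OF 1] m ent by (simp add: nth_append)
    next
      case 2
      then have "r = c - length es" "m \<in> Poly_Mapping.keys s" using m ent by (auto split: if_splits)
      then show ?thesis using 2 s c by (simp add: nth_append)
    next
      case 3
      then have "\<not> c < length es" "m \<in> Poly_Mapping.keys (B $$ (r - length ds, c - length es))"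
        using m ent by (auto split: if_splits)
      then show ?thesis using 3 r c dB[of "r - length ds" "c - length es" m] by (simp add: nth_append)
    qed
  qed
  then show ?thesis
    using cone_mat_carrier[OF cA cB] by (simp add: graded_map_def)
qed

lemma keys_sign_mult: "Poly_Mapping.keys ((- 1) ^ i * f) = Poly_Mapping.keys (f :: ('v, 'k::field) mpol)"
  by (cases "even i") auto

lemma koszul_graded:
  assumes "list_all2 (\<lambda>f e. \<forall>m\<in>Poly_Mapping.keys f. mon_degree m = e) fs es"
  shows "graded_map (koszul_degrees es i) (koszul_degrees es (Suc i)) (koszul_map fs (Suc i))"
  using assms
proof (induction fs es arbitrary: i rule: list_all2_induct)
  case Nil
  then show ?case by (cases i) (auto simp: graded_map_def)
next
  case (Cons f fs e es)
  have s: "\<forall>m\<in>Poly_Mapping.keys ((- 1) ^ i * f). mon_degree m = e"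
    using Cons by (simp add: keys_sign_mult)
  show ?case
  proof (cases i)
    case 0
    then show ?thesis
      using graded_map_cone[OF Cons.IH[of 0] _ s, where B = "0\<^sub>m 0 1" and cs = "[]"]
      by (simp add: koszul_map_0 koszul_degrees_0)
  next
    case (Suc j)
    have "graded_map (koszul_degrees es j) (koszul_degrees es i) (koszul_map fs i)"
      unfolding Suc by (rule Cons.IH)
    then show ?thesis
      using graded_map_cone[OF Cons.IH[of i] _ s, where cs = "koszul_degrees es j" and B = "koszul_map fs i"]
      by (simp add: Suc)
  qed
qed

lemma koszul_minimal:
  assumes "\<forall>f\<in>set fs. Poly_Mapping.lookup (f :: ('v, 'k::field) mpol) 0 = 0"
    and "r < dim_row (koszul_map fs i)" "c < dim_col (koszul_map fs i)"
  shows "Poly_Mapping.lookup (koszul_map fs i $$ (r, c)) 0 = 0"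
  using assms
proof (induction fs i arbitrary: r c rule: koszul_map.induct)
  case (5 f fs i)
  let ?A = "koszul_map fs (Suc i)" and ?B = "koszul_map fs i"
  have dim: "dim_row ?A = dim_col ?B"
    using koszul_map_carrier[of fs i] koszul_map_carrier[of fs "i - 1"] by (cases i) (auto simp: koszul_map_0)
  have rc: "r < dim_row ?A + dim_row ?B" "c < dim_col ?A + dim_col ?B"
    using 5 by (auto simp: cone_mat_def)
  have "koszul_map (f # fs) (Suc i) $$ (r, c) =
      (if r < dim_row ?A then
         if c < dim_col ?A then ?A $$ (r, c) else if r = c - dim_col ?A then (- 1) ^ i * f else 0
       else if c < dim_col ?A then 0 else ?B $$ (r - dim_row ?A, c - dim_col ?A))"
    using rc dim by (auto simp: cone_mat_def)
  moreover have "Poly_Mapping.lookup ((- 1) ^ i * f) 0 = 0"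
    using 5(3) by (simp add: const_coeff_mult)
  ultimately show ?case
    using 5 rc by auto
qed auto

lemma mon_degree_0: "mon_degree 0 = 0"
  by (simp add: mon_degree_def)

text \<open>
  Multiplication by a nonzerodivisor \<open>h\<close> is an isomorphism onto the ideal multiplied by \<open>h\<close>, so it
  is enough to scale the augmentation by \<open>h\<close> and to shift all degrees by the degree of \<open>h\<close>. The
  Koszul complex resolves the quotient ring, hence the shift of the homological degree by one.
\<close>

lemma koszul_resolution:
  fixes h :: "('v::finite, 'k::field) mpol"
  assumes reg: "regular_sequence fs"
    and hom: "list_all2 (\<lambda>f e. \<forall>m\<in>Poly_Mapping.keys f. mon_degree m = e) fs es"
    and pos: "\<forall>e\<in>set es. 1 \<le> e"
    and h: "\<forall>m\<in>Poly_Mapping.keys h. mon_degree m = b" "\<And>g. h * g = 0 \<Longrightarrow> g = 0"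
  shows "minimal_graded_free_resolution ((*) h ` ideal.span (set fs))
    (\<lambda>i. map (\<lambda>j. j + b) (koszul_degrees es (Suc i)))
    (\<lambda>i. case i of 0 \<Rightarrow> h \<cdot>\<^sub>m koszul_map fs (Suc 0) | Suc j \<Rightarrow> koszul_map fs (Suc (Suc j)))"
    (is "minimal_graded_free_resolution _ ?d ?A")
  unfolding minimal_graded_free_resolution_def
proof (intro conjI)
  let ?K = "koszul_map fs"
  note gK = koszul_graded[OF hom]
  have K: "?K (Suc 0) \<in> carrier_mat 1 (length fs)"
    using koszul_map_carrier[of fs 0] by simp
  have len: "length es = length fs"
    using hom by (simp add: list_all2_lengthD)
  have smult: "(h \<cdot>\<^sub>m ?K (Suc 0)) *\<^sub>v v = h \<cdot>\<^sub>v (?K (Suc 0) *\<^sub>v v)" if "v \<in> carrier_vec (length fs)" for v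
    using smult_mat_mult_vec[OF K that] .
  show "graded_map [0] (?d 0) (?A 0)"
  proof -
    have "mon_degree m = koszul_degrees es (Suc 0) ! c + b"
      if c: "c < length fs" and m: "m \<in> Poly_Mapping.keys (h * ?K (Suc 0) $$ (0, c))" for c m
    proof -
      obtain k l where "m = k + l" "k \<in> Poly_Mapping.keys h" "l \<in> Poly_Mapping.keys (?K (Suc 0) $$ (0, c))"
        using keys_mult m by blast
      moreover from this have "mon_degree l = koszul_degrees es (Suc 0) ! c"
        using gK[of 0] c len by (auto simp: graded_map_def koszul_degrees_0 length_koszul_degrees)
      ultimately show ?thesis using h(1) by (simp add: mon_degree_add)
    qed
    then show ?thesis
      using K len by (auto simp: graded_map_def length_koszul_degrees)
  qed
  show "\<forall>i. graded_map (?d i) (?d (Suc i)) (?A (Suc i))"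
    using gK by (auto simp: graded_map_def)
  show "(\<lambda>v. v $ 0) ` mat_image (?A 0) = (*) h ` ideal.span (set fs)"
  proof -
    have "mat_image (?A 0) = (\<lambda>v. h \<cdot>\<^sub>v v) ` mat_image (?K (Suc 0))"
    proof -
      have "mat_image (?A 0) = (\<lambda>v. (h \<cdot>\<^sub>m ?K (Suc 0)) *\<^sub>v v) ` carrier_vec (length fs)"
        using mat_image_eq[OF smult_carrier_mat[OF K]] by simp
      also have "\<dots> = (\<lambda>v. h \<cdot>\<^sub>v (?K (Suc 0) *\<^sub>v v)) ` carrier_vec (length fs)"
        by (rule image_cong[OF refl smult])
      finally show ?thesis
        by (simp only: mat_image_eq[OF K] image_image)
    qed
    then have "(\<lambda>v. v $ 0) ` mat_image (?A 0) = (\<lambda>v. (h \<cdot>\<^sub>v v) $ 0) ` mat_image (?K (Suc 0))"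
      by (simp add: image_image)
    also have "\<dots> = (\<lambda>v. h * v $ 0) ` mat_image (?K (Suc 0))"
      using K by (intro image_cong) (auto simp: mat_image_def)
    also have "\<dots> = (*) h ` (\<lambda>v. v $ 0) ` mat_image (?K (Suc 0))"
      by (simp add: image_image)
    finally show ?thesis by (simp add: koszul_augmentation)
  qed
  show "\<forall>i. mat_kernel (?A i) = mat_image (?A (Suc i))"
  proof
    fix i
    have "mat_kernel (h \<cdot>\<^sub>m ?K (Suc 0)) = mat_kernel (?K (Suc 0))"
    proof -
      have "h \<cdot>\<^sub>v x = 0\<^sub>v 1 \<longleftrightarrow> x = 0\<^sub>v 1" if "x \<in> carrier_vec 1" for x
        using that h(2) by (auto simp: vec_eq_iff)
      then show ?thesis
        using K smult unfolding mat_kernel[OF K] mat_kernel[OF smult_carrier_mat[OF K]] by auto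
    qed
    then show "mat_kernel (?A i) = mat_image (?A (Suc i))"
      using koszul_exact[OF reg] by (cases i) auto
  qed
  have "Poly_Mapping.lookup f 0 = 0" if f: "f \<in> set fs" for f
  proof -
    obtain i where i: "i < length fs" "f = fs ! i"
      using f unfolding in_set_conv_nth by blast
    have "1 \<le> es ! i"
      using pos i(1) len by simp
    moreover have "\<forall>m\<in>Poly_Mapping.keys f. mon_degree m = es ! i"
      unfolding i(2) by (rule list_all2_nthD[OF hom i(1)])
    ultimately have "0 \<notin> Poly_Mapping.keys f"
      by (metis mon_degree_0 not_one_le_zero)
    then show ?thesis by (simp add: in_keys_iff)
  qed
  then show "\<forall>i. \<forall>r<length (?d i). \<forall>c<length (?d (Suc i)). Poly_Mapping.lookup (?A (Suc i) $$ (r, c)) 0 = 0"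
    using koszul_minimal[of fs] carrier_matD[OF koszul_map_carrier[of fs]] len by (auto simp: length_koszul_degrees)
qed

section \<open>Monomial regular sequences\<close>

abbreviation monomial :: "('v \<Rightarrow>\<^sub>0 nat) \<Rightarrow> ('v, 'k::field) mpol" where
  "monomial t \<equiv> Poly_Mapping.single t 1"

lemma monomial_mult: "monomial s * monomial t = monomial (s + t)"
  by (simp add: mult_single)

text \<open>
  Membership in a monomial ideal can be tested on each monomial of \<open>p\<close> separately.
\<close>

lemma mem_monomial_ideal_iff:
  "p \<in> ideal.span (monomial ` T) \<longleftrightarrow> (\<forall>u\<in>Poly_Mapping.keys p. \<exists>t\<in>T. \<exists>r. u = r + t)"
proof
  assume "p \<in> ideal.span (monomial ` T)"
  then show "\<forall>u\<in>Poly_Mapping.keys p. \<exists>t\<in>T. \<exists>r. u = r + t"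
  proof (induction rule: ideal.span_induct_alt)
    case base
    then show ?case by simp
  next
    case (step c x y)
    then obtain t where t: "t \<in> T" "x = monomial t" by blast
    show ?case
    proof
      fix u assume "u \<in> Poly_Mapping.keys (c * x + y)"
      then consider "u \<in> Poly_Mapping.keys (c * x)" | "u \<in> Poly_Mapping.keys y"
        using keys_add[of "c * x" y] by blast
      then show "\<exists>t\<in>T. \<exists>r. u = r + t"
      proof cases
        case 1
        then obtain k l where "u = k + l" "l \<in> Poly_Mapping.keys x"
          using keys_mult[of c x] by blast
        then show ?thesis using t by (auto split: if_splits)
      next
        case 2
        then show ?thesis using step by blast
      qed
    qed
  qed
next
  assume "\<forall>u\<in>Poly_Mapping.keys p. \<exists>t\<in>T. \<exists>r. u = r + t"
  then show "p \<in> ideal.span (monomial ` T)"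
  proof (induction p rule: update_induct)
    case const
    then show ?case by (simp add: ideal.span_zero)
  next
    case (update q a b)
    note eq = update_eq_add_single[OF update(1)]
    obtain t r where t: "t \<in> T" "a = r + t"
      using update(2,4) by (auto simp: keys_update)
    have "Poly_Mapping.single r b * monomial t \<in> ideal.span (monomial ` T)"
      using t(1) by (intro ideal.span_scale ideal.span_base imageI)
    then have "Poly_Mapping.single a b \<in> ideal.span (monomial ` T)"
      by (simp add: mult_single t(2))
    moreover have "q \<in> ideal.span (monomial ` T)"
      using update by (auto simp: keys_update)
    ultimately show ?case
      unfolding eq by (intro ideal.span_add)
  qed
qed

text \<open>
  If a monomial \<open>t\<close> divides \<open>s + u\<close> (in exponents) and has no variable in common with \<open>s\<close>, then it
  already divides \<open>u\<close>.
\<close>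

lemma coprime_monomial_nonzerodivisor:
  assumes disj: "\<And>t v. t \<in> T \<Longrightarrow> Poly_Mapping.lookup s v = 0 \<or> Poly_Mapping.lookup t v = 0"
    and g: "g * monomial s \<in> ideal.span (monomial ` T)"
  shows "g \<in> ideal.span (monomial ` T)"
  unfolding mem_monomial_ideal_iff
proof
  fix u assume "u \<in> Poly_Mapping.keys g"
  then have "s + u \<in> Poly_Mapping.keys (g * monomial s)"
    using lookup_single_mult[of s 1 g u] by (simp add: in_keys_iff mult.commute)
  then obtain t r where t: "t \<in> T" "s + u = r + t"
    using g unfolding mem_monomial_ideal_iff by blast
  have "Poly_Mapping.lookup t v \<le> Poly_Mapping.lookup u v" for v
    using disj[OF t(1), of v] arg_cong[OF t(2), of "\<lambda>m. Poly_Mapping.lookup m v"]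
    by (auto simp: lookup_add)
  then have "u = (u - t) + t"
    by (intro poly_mapping_eqI) (simp add: lookup_add lookup_minus)
  then show "\<exists>t\<in>T. \<exists>r. u = r + t" using t(1) by blast
qed

text \<open>
  Multiplication by a monomial only moves the coefficients, so none of them is lost.
\<close>

lemma monomial_nonzerodivisor:
  assumes "monomial s * g = (0 :: ('v, 'k::field) mpol)"
  shows "g = 0"
proof (rule poly_mapping_eqI)
  fix u
  show "Poly_Mapping.lookup g u = Poly_Mapping.lookup 0 u"
    using lookup_single_mult[of s 1 g u] assms by simp
qed

definition disjoint_exponents :: "('v \<Rightarrow>\<^sub>0 nat) \<Rightarrow> ('v \<Rightarrow>\<^sub>0 nat) \<Rightarrow> bool" where
  "disjoint_exponents s t \<longleftrightarrow> (\<forall>v. Poly_Mapping.lookup s v = 0 \<or> Poly_Mapping.lookup t v = 0)"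

lemma regular_sequence_monomials:
  assumes "sorted_wrt disjoint_exponents ts"
  shows "regular_sequence (map monomial ts :: ('v, 'k::field) mpol list)"
  using assms
proof (induction ts)
  case (Cons t ts)
  then show ?case
    using coprime_monomial_nonzerodivisor[of "set ts" t] by (auto simp: disjoint_exponents_def)
qed simp

lemma span_scaled: "ideal.span ((*) h ` S) = (*) h ` ideal.span S" for h :: "'a::comm_ring_1"
proof
  show "ideal.span ((*) h ` S) \<subseteq> (*) h ` ideal.span S"
  proof (rule ideal.span_minimal)
    show "(*) h ` S \<subseteq> (*) h ` ideal.span S"
      by (rule image_mono[OF ideal.span_superset])
    show "ideal.subspace ((*) h ` ideal.span S)"
    proof (rule ideal.subspaceI)
      show "0 \<in> (*) h ` ideal.span S"
        by (rule image_eqI[of _ _ 0]) (simp_all add: ideal.span_zero)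
    next
      fix x y assume "x \<in> (*) h ` ideal.span S" "y \<in> (*) h ` ideal.span S"
      then obtain a b where "x = h * a" "y = h * b" "a \<in> ideal.span S" "b \<in> ideal.span S" by blast
      then show "x + y \<in> (*) h ` ideal.span S"
        by (intro image_eqI[of _ _ "a + b"]) (simp_all add: distrib_left ideal.span_add)
    next
      fix c x assume "x \<in> (*) h ` ideal.span S"
      then obtain a where "x = h * a" "a \<in> ideal.span S" by blast
      then show "c * x \<in> (*) h ` ideal.span S"
        by (intro image_eqI[of _ _ "c * a"]) (simp_all add: mult.left_commute ideal.span_scale)
    qed
  qed
  show "(*) h ` ideal.span S \<subseteq> ideal.span ((*) h ` S)"
  proof (rule image_subsetI)
    fix x assume "x \<in> ideal.span S"
    then show "h * x \<in> ideal.span ((*) h ` S)"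
    proof (induction rule: ideal.span_induct_alt)
      case base
      then show ?case by (simp add: ideal.span_zero)
    next
      case (step c x y)
      have "c * (h * x) \<in> ideal.span ((*) h ` S)"
        using step(1) by (intro ideal.span_scale ideal.span_base imageI)
      then have "c * (h * x) + h * y \<in> ideal.span ((*) h ` S)"
        using step(2) by (rule ideal.span_add)
      moreover have "h * (c * x + y) = c * (h * x) + h * y"
        by (simp only: distrib_left mult.left_commute[of h])
      ultimately show ?case by simp
    qed
  qed
qed

section \<open>Invariants of a shifted monomial complete intersection\<close>

text \<open>
  The ideal is the complete intersection of the monomials \<open>ts\<close> multiplied by the monomial \<open>s\<close>. Its
  resolution has length \<open>length ts - 1\<close>, and the regularity is attained at the last module, which is
  generated in the sum of all degrees.
\<close>

theorem invariants_shifted_monomial_complete_intersection: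
  fixes ts :: "('v::finite \<Rightarrow>\<^sub>0 nat) list"
  assumes ne: "ts \<noteq> []" and disj: "sorted_wrt disjoint_exponents ts" and pos: "\<forall>t\<in>set ts. 1 \<le> mon_degree t"
    and I: "I = (ideal.span ((\<lambda>t. monomial (s + t)) ` set ts) :: ('v, 'k::field) mpol set)"
  shows "proj_dim I = length ts - 1"
    and "regularity I = int (mon_degree s) + (\<Sum>t\<leftarrow>ts. int (mon_degree t)) - int (length ts) + 1"
proof -
  let ?fs = "map monomial ts :: ('v, 'k) mpol list" and ?es = "map mon_degree ts"
  let ?d = "\<lambda>i. map (\<lambda>j. j + mon_degree s) (koszul_degrees ?es (Suc i))"
  have I': "I = (*) (monomial s) ` ideal.span (set ?fs)"
    unfolding I span_scaled[symmetric] by (simp add: image_image monomial_mult)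
  have "minimal_graded_free_resolution I ?d
     (\<lambda>i. case i of 0 \<Rightarrow> monomial s \<cdot>\<^sub>m koszul_map ?fs (Suc 0) | Suc j \<Rightarrow> koszul_map ?fs (Suc (Suc j)))"
    unfolding I'
  proof (rule koszul_resolution)
    show "regular_sequence ?fs" by (rule regular_sequence_monomials[OF disj])
    show "list_all2 (\<lambda>f e. \<forall>m\<in>Poly_Mapping.keys f. mon_degree m = e) ?fs ?es"
      by (simp add: list_all2_conv_all_nth)
    show "\<forall>e\<in>set ?es. 1 \<le> e" using pos by simp
    show "\<forall>m\<in>Poly_Mapping.keys (monomial s :: ('v, 'k) mpol). mon_degree m = mon_degree s" by simp
    show "\<And>g. monomial s * g = (0 :: ('v, 'k) mpol) \<Longrightarrow> g = 0" by (rule monomial_nonzerodivisor)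
  qed
  then have betti: "graded_betti I i j \<noteq> 0 \<longleftrightarrow> j \<in> set (?d i)" for i j
    by (simp add: graded_betti_eq_count count_list_0_iff)
  have nonempty: "?d i \<noteq> [] \<longleftrightarrow> i < length ts" for i
    using length_koszul_degrees[of ?es "Suc i"] by (auto simp: Suc_le_eq simp flip: length_0_conv)
  have ex_set: "(\<exists>j. j \<in> set xs) \<longleftrightarrow> xs \<noteq> []" for xs :: "nat list"
    by (cases xs) auto
  have "{i. \<exists>j. graded_betti I i j \<noteq> 0} = {..<length ts}"
    unfolding betti ex_set nonempty by blast
  then show "proj_dim I = length ts - 1"
    using ne unfolding proj_dim_def by (intro Max_eqI) auto
  let ?R = "int (mon_degree s) + (\<Sum>t\<leftarrow>ts. int (mon_degree t)) - int (length ts) + 1"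
  have sum: "(\<Sum>t\<leftarrow>ts. int (mon_degree t)) = int (sum_list ?es)"
    by (induction ts) auto
  show "regularity I = ?R"
    unfolding regularity_def
  proof (rule Max_eqI)
    have bound: "int j - int i \<le> ?R" "i < length ts" if nz: "graded_betti I i j \<noteq> 0" for i j
    proof -
      obtain j' where j': "j' \<in> set (koszul_degrees ?es (Suc i))" "j = j' + mon_degree s"
        using nz unfolding betti by auto
      have "j' + length ts \<le> sum_list ?es + Suc i"
        using koszul_degrees_bound[OF _ j'(1)] pos by simp
      then show "int j - int i \<le> ?R" using j'(2) unfolding sum by linarith
      show "i < length ts" using nz nonempty[of i] unfolding betti by force
    qed
    then show "y \<le> ?R" if "y \<in> {int j - int i |i j. graded_betti I i j \<noteq> 0}" for y
      using that by blast
    have "{int j - int i |i j. graded_betti I i j \<noteq> 0} \<subseteq> {- int (length ts)..?R}"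
      using bound by force
    then show "finite {int j - int i |i j. graded_betti I i j \<noteq> 0}"
      using finite_subset by blast
    let ?i = "length ts - 1" and ?j = "sum_list ?es + mon_degree s"
    have "koszul_degrees ?es (Suc ?i) = [sum_list ?es]"
      using koszul_degrees_top[of ?es] ne by simp
    then have "graded_betti I ?i ?j \<noteq> 0"
      unfolding betti by simp
    moreover have "?R = int ?j - int ?i"
      using ne unfolding sum by (simp add: of_nat_diff Suc_le_eq)
    ultimately show "?R \<in> {int j - int i |i j. graded_betti I i j \<noteq> 0}"
      by blast
  qed
qed

section \<open>Weighted oriented stars\<close>

lemma mvar_power: "mvar v ^ k = monomial (Poly_Mapping.single v k)"
  by (induction k) (simp_all add: mvar_def mult_single flip: single_add)

lemma mon_degree_single: "mon_degree (Poly_Mapping.single v k) = k"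
  by (simp add: mon_degree_def lookup_single when_def)

lemma edge_ideal_monomials:
  "(edge_ideal E w :: ('v::finite, 'k::field) mpol set) =
     ideal.span ((\<lambda>(u, v). monomial (Poly_Mapping.single u 1 + Poly_Mapping.single v (w v))) ` E)"
proof -
  have "mvar u * mvar v ^ k = (monomial (Poly_Mapping.single u 1 + Poly_Mapping.single v k) :: ('v, 'k) mpol)"
    for u v k
    unfolding mvar_power by (simp add: mvar_def mult_single)
  then have "{mvar u * mvar v ^ w v | u v. (u, v) \<in> E} =
      (\<lambda>(u, v). monomial (Poly_Mapping.single u 1 + Poly_Mapping.single v (w v)) :: ('v, 'k) mpol) ` E"
    by (simp only:) force
  then show ?thesis
    by (simp only: edge_ideal_def)
qed

theorem theorem1p1:
  fixes x :: "nat \<Rightarrow> 'v::finite"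
    and n :: nat
    and E :: "('v \<times> 'v) set"
    and w :: "'v \<Rightarrow> nat"
  assumes "2 \<le> n"
    and "bij_betw x {1..n} (UNIV :: 'v set)"
    and "weighted_oriented_graph E w"
    and "star_graph E"
    and "\<And>v. \<exists>u. (u, v) \<in> E \<Longrightarrow> 2 \<le> w v"
    and "E = {(x 1, x j) | j. 2 \<le> j \<and> j \<le> n} \<or>
         E = {(x j, x 1) | j. 2 \<le> j \<and> j \<le> n} \<or>
         E = insert (x 1, x 2) {(x 2, x j) | j. 3 \<le> j \<and> j \<le> n}"
  shows "int (proj_dim (edge_ideal E w :: ('v, 'k::field) mpol set)) = int (card E) - 1 \<and>
         regularity (edge_ideal E w :: ('v, 'k) mpol set) =
           (\<Sum>v\<in>UNIV. int (normalized_weight E w v)) - int (card E) + 1"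
proof -
  let ?I = "edge_ideal E w :: ('v, 'k) mpol set"
  let ?e = "\<lambda>j k. Poly_Mapping.single (x j) k"
  have inj: "x i = x j \<longleftrightarrow> i = j" if "i \<in> {1..n}" "j \<in> {1..n}" for i j
    by (rule inj_on_eq_iff[OF bij_betw_imp_inj_on[OF assms(2)] that])
  have head_weight: "1 \<le> w v" if "(u, v) \<in> E" for u v
    using assms(5)[of v] that by fastforce
  have norm_head: "normalized_weight E w v = w v" if "(u, v) \<in> E" for u v
    using that by (auto simp: normalized_weight_def)
  have norm_source: "normalized_weight E w v = 1" if "\<And>u. (u, v) \<notin> E" for v
    using that by (auto simp: normalized_weight_def)
  have total: "(\<Sum>v\<in>UNIV. f v) = (\<Sum>j=1..n. f (x j))" for f :: "'v \<Rightarrow> int"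
    using sum.reindex_bij_betw[OF assms(2), of f] by simp
  have split1: "(\<Sum>j=1..n. g j) = g 1 + (\<Sum>j=2..n. g j)" for g :: "nat \<Rightarrow> int"
    using assms(1) sum.atLeast_Suc_atMost[of 1 n g] by (simp add: numeral_2_eq_2)
  have split2: "(\<Sum>j=2..n. g j) = g 2 + (\<Sum>j=3..n. g j)" for g :: "nat \<Rightarrow> int"
    using assms(1) sum.atLeast_Suc_atMost[of 2 n g] by (simp add: numeral_3_eq_3 numeral_2_eq_2)
  \<comment> \<open>It remains to write the edge ideal as a monomial s times pairwise coprime monomials ts, and to
    compare the degrees with the sum of the normalised weights.\<close>
  have finish: ?thesis
    if "card E = n - 1" "length ts = n - 1" "sorted_wrt disjoint_exponents ts"
      "\<forall>t\<in>set ts. 1 \<le> mon_degree t"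
      "(\<lambda>(u, v). Poly_Mapping.single u 1 + Poly_Mapping.single v (w v)) ` E = (\<lambda>t. s + t) ` set ts"
      "int (mon_degree s) + (\<Sum>t\<leftarrow>ts. int (mon_degree t)) = (\<Sum>j=1..n. int (normalized_weight E w (x j)))"
    for ts s
  proof -
    have ne: "ts \<noteq> []" using that(2) assms(1) by auto
    have "(\<lambda>(u, v). monomial (Poly_Mapping.single u 1 + Poly_Mapping.single v (w v)) :: ('v, 'k) mpol) ` E
        = monomial ` (\<lambda>(u, v). Poly_Mapping.single u 1 + Poly_Mapping.single v (w v)) ` E"
      by (simp add: image_image case_prod_unfold)
    then have I: "?I = ideal.span ((\<lambda>t. monomial (s + t)) ` set ts)"
      unfolding edge_ideal_monomials that(5) by (simp add: image_image)
    show ?thesis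
      using invariants_shifted_monomial_complete_intersection[OF ne that(3,4) I] that(1,2,6) assms(1)
      by (simp add: total of_nat_diff)
  qed
  have disj: "disjoint_exponents (?e i k) (?e j l)" if "i \<in> {1..n}" "j \<in> {1..n}" "i \<noteq> j" for i j k l
    using inj[OF that(1,2)] that(3) by (auto simp: disjoint_exponents_def lookup_single when_def)
  have sorted: "sorted_wrt disjoint_exponents (map (\<lambda>j. ?e j (f j)) [a..<Suc n])" if "1 \<le> a" for a f
    unfolding sorted_wrt_map
    by (rule sorted_wrt_mono_rel[OF _ sorted_wrt_upt]) (use that disj in auto)
  have degrees: "\<forall>t\<in>set (map (\<lambda>j. ?e j (f j)) [a..<Suc n]). 1 \<le> mon_degree t"
    if "\<And>j. j \<in> {a..n} \<Longrightarrow> 1 \<le> f j" for a f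
    using that by (auto simp: mon_degree_single simp del: upt_Suc)
  have upt_sum: "(\<Sum>t\<leftarrow>map (\<lambda>j. ?e j (f j)) [a..<Suc n]. int (mon_degree t)) = (\<Sum>j=a..n. int (f j))" for a f
    by (simp add: mon_degree_single comp_def interv_sum_list_conv_sum_set_nat atLeastLessThanSuc_atLeastAtMost
        del: upt_Suc)
  have card_edges: "card ((\<lambda>j. p j) ` {2..n}) = n - 1" if "inj_on p {2..n}" for p :: "nat \<Rightarrow> 'v \<times> 'v"
    using card_image[OF that] by simp
  consider "E = {(x 1, x j) | j. 2 \<le> j \<and> j \<le> n}" | "E = {(x j, x 1) | j. 2 \<le> j \<and> j \<le> n}"
    | "E = insert (x 1, x 2) {(x 2, x j) | j. 3 \<le> j \<and> j \<le> n}"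
    using assms(6) by blast
  then show ?thesis
  proof cases
    case 1
    \<comment> \<open>The ideal is x 1 times the complete intersection of the powers (x j) ^ w (x j).\<close>
    have E: "E = (\<lambda>j. (x 1, x j)) ` {2..n}" using 1 by auto
    have w: "1 \<le> w (x j)" if "j \<in> {2..n}" for j
      by (rule head_weight[of "x 1"]) (use E that in simp)
    show ?thesis
    proof (rule finish[of "map (\<lambda>j. ?e j (w (x j))) [2..<Suc n]" "?e 1 1"])
      show "card E = n - 1"
        unfolding E by (rule card_edges) (auto simp: inj_on_def inj)
      show "(\<lambda>(u, v). Poly_Mapping.single u 1 + Poly_Mapping.single v (w v)) ` E
        = (\<lambda>t. ?e 1 1 + t) ` set (map (\<lambda>j. ?e j (w (x j))) [2..<Suc n])"
        unfolding E by (simp add: image_image atLeastLessThanSuc_atLeastAtMost del: upt_Suc)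
      have "normalized_weight E w (x 1) = 1"
        by (rule norm_source) (use assms(1) in \<open>auto simp: E inj\<close>)
      moreover have "normalized_weight E w (x j) = w (x j)" if "j \<in> {2..n}" for j
        by (rule norm_head[of "x 1"]) (use that in \<open>simp add: E\<close>)
      ultimately show "int (mon_degree (?e 1 1)) + (\<Sum>t\<leftarrow>map (\<lambda>j. ?e j (w (x j))) [2..<Suc n]. int (mon_degree t))
        = (\<Sum>j=1..n. int (normalized_weight E w (x j)))"
        unfolding upt_sum split1 by (simp add: mon_degree_single)
      show "sorted_wrt disjoint_exponents (map (\<lambda>j. ?e j (w (x j))) [2..<Suc n])"
        by (rule sorted) simp
      show "\<forall>t\<in>set (map (\<lambda>j. ?e j (w (x j))) [2..<Suc n]). 1 \<le> mon_degree t"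
        by (rule degrees) (rule w)
    qed (simp del: upt_Suc)
  next
    case 2
    \<comment> \<open>The ideal is (x 1) ^ w (x 1) times the ideal generated by the other variables.\<close>
    have E: "E = (\<lambda>j. (x j, x 1)) ` {2..n}" using 2 by auto
    show ?thesis
    proof (rule finish[of "map (\<lambda>j. ?e j 1) [2..<Suc n]" "?e 1 (w (x 1))"])
      show "card E = n - 1"
        unfolding E by (rule card_edges) (auto simp: inj_on_def inj)
      show "(\<lambda>(u, v). Poly_Mapping.single u 1 + Poly_Mapping.single v (w v)) ` E
        = (\<lambda>t. ?e 1 (w (x 1)) + t) ` set (map (\<lambda>j. ?e j 1) [2..<Suc n])"
        unfolding E by (simp add: image_image atLeastLessThanSuc_atLeastAtMost add.commute del: upt_Suc)
      have "normalized_weight E w (x 1) = w (x 1)"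
        by (rule norm_head[of "x 2"]) (use assms(1) in \<open>simp add: E\<close>)
      moreover have "normalized_weight E w (x j) = 1" if "j \<in> {2..n}" for j
        by (rule norm_source) (use that in \<open>auto simp: E inj\<close>)
      ultimately show "int (mon_degree (?e 1 (w (x 1)))) + (\<Sum>t\<leftarrow>map (\<lambda>j. ?e j 1) [2..<Suc n]. int (mon_degree t))
        = (\<Sum>j=1..n. int (normalized_weight E w (x j)))"
        unfolding upt_sum split1 by (simp add: mon_degree_single)
      show "sorted_wrt disjoint_exponents (map (\<lambda>j. ?e j 1) [2..<Suc n])"
        by (rule sorted) simp
      show "\<forall>t\<in>set (map (\<lambda>j. ?e j 1) [2..<Suc n]). 1 \<le> mon_degree t"
        by (rule degrees) simp
    qed (simp del: upt_Suc)
  next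
    case 3
    \<comment> \<open>After factoring out x 2, the first generator is x 1 times the power of x 2 with exponent
      w (x 2) - 1, and the others are the powers (x j) ^ w (x j). So x 2 contributes its weight in two parts.\<close>
    have E: "E = insert (x 1, x 2) ((\<lambda>j. (x 2, x j)) ` {3..n})" using 3 by auto
    have w: "1 \<le> w (x j)" if "j \<in> {2..n}" for j
      by (rule head_weight[of "if j = 2 then x 1 else x 2"]) (use E that in auto)
    let ?t = "?e 1 1 + ?e 2 (w (x 2) - 1)" and ?ts = "map (\<lambda>j. ?e j (w (x j))) [3..<Suc n]"
    have first: "?e 2 1 + ?t = ?e 1 1 + ?e 2 (w (x 2))"
      using w[of 2] assms(1) by (simp add: add.left_commute flip: single_add)
    show ?thesis
    proof (rule finish[of "?t # ?ts" "?e 2 1"])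
      have "card E = Suc (card ((\<lambda>j. (x 2, x j)) ` {3..n}))"
        unfolding E using inj[of 1 2] assms(1) by (intro card_insert_disjoint) auto
      also have "card ((\<lambda>j. (x 2, x j)) ` {3..n}) = n - 2"
        by (subst card_image) (auto simp: inj_on_def inj)
      finally show "card E = n - 1" using assms(1) by simp
      show "length (?t # ?ts) = n - 1" using assms(1) by (simp del: upt_Suc)
      have "disjoint_exponents ?t (?e j k)" if "j \<in> {3..n}" for j k
        using disj[of 1 j 1 k] disj[of 2 j "w (x 2) - 1" k] that
        by (auto simp: disjoint_exponents_def lookup_add)
      then show "sorted_wrt disjoint_exponents (?t # ?ts)"
        using sorted[of 3 "\<lambda>j. w (x j)"] by (auto simp del: upt_Suc)
      show "\<forall>t\<in>set (?t # ?ts). 1 \<le> mon_degree t"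
        unfolding list.set ball_simps
      proof
        show "1 \<le> mon_degree ?t" by (simp add: mon_degree_single mon_degree_add)
        show "\<forall>t\<in>set ?ts. 1 \<le> mon_degree t" by (rule degrees) (rule w, simp)
      qed
      show "(\<lambda>(u, v). Poly_Mapping.single u 1 + Poly_Mapping.single v (w v)) ` E
        = (\<lambda>t. ?e 2 1 + t) ` set (?t # ?ts)"
        unfolding E list.set image_insert first by (simp add: image_image atLeastLessThanSuc_atLeastAtMost del: upt_Suc)
      have "normalized_weight E w (x 1) = 1"
        by (rule norm_source) (use assms(1) in \<open>auto simp: E inj\<close>)
      moreover have "normalized_weight E w (x j) = w (x j)" if "j \<in> {2..n}" for j
        by (rule norm_head[of "if j = 2 then x 1 else x 2"]) (use that in \<open>auto simp: E\<close>)
      ultimately show "int (mon_degree (?e 2 1)) + (\<Sum>t\<leftarrow>?t # ?ts. int (mon_degree t))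
        = (\<Sum>j=1..n. int (normalized_weight E w (x j)))"
        using upt_sum[of "\<lambda>j. w (x j)" 3] w[of 2] assms(1)
        unfolding split1 split2 by (simp add: mon_degree_single mon_degree_add of_nat_diff del: upt_Suc)
    qed
  qed
qed

end
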